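(* Let $r$ and $s$ be positive integers and let $G$ be a finite simple graph of order $n=3r+4s$ with $\sigma_{2}(G)\geq n+r$. Then $G$ contains $r$ triangles, $s-1$ quadrilaterals and a subgraph $D$ of order four with at least four edges, all pairwise vertex-disjoint (i.e. $G\supseteq rC_{3}\cup(s-1)C_{4}\cup D$).
   Context: All graphs are finite, simple and undirected. For a graph $G$, $\sigma_{2}(G)=\min\{d(x)+d(y): x,y\in V(G),\ x\neq y,\ xy\notin E(G)\}$, where $d(v)$ is the degree of $v$; if $G$ is complete, $\sigma_2(G)=\infty$. $C_k$ denotes a cycle with $k$ vertices; $C_3$ is a triangle and $C_4$ a quadrilateral. $mQ$ denotes $m$ vertex-disjoint copies of $Q$, and $G\supseteq A\cup B$ means $G$ contains vertex-disjoint subgraphs isomorphic to $A$ and $B$ (not necessarily induced). *)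

theory Defs
  imports Main
begin

definition simple_graph :: "'a set \<Rightarrow> 'a set set \<Rightarrow> bool" where
  "simple_graph V E \<longleftrightarrow> finite V \<and> (\<forall>e\<in>E. \<exists>x y. x \<in> V \<and> y \<in> V \<and> x \<noteq> y \<and> e = {x, y})"

definition degree :: "'a set \<Rightarrow> 'a set set \<Rightarrow> 'a \<Rightarrow> nat" where
  "degree V E v = card {u \<in> V. {u, v} \<in> E}"

(* sigma_2(G) >= k, with the convention sigma_2 = infinity for complete graphs *)
definition sigma2_ge :: "'a set \<Rightarrow> 'a set set \<Rightarrow> nat \<Rightarrow> bool" where
  "sigma2_ge V E k \<longleftrightarrow>
     (\<forall>x\<in>V. \<forall>y\<in>V. x \<noteq> y \<and> {x, y} \<notin> E \<longrightarrow> degree V E x + degree V E y \<ge> k)"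

definition is_triangle :: "'a set \<Rightarrow> 'a set set \<Rightarrow> 'a set \<Rightarrow> bool" where
  "is_triangle V E S \<longleftrightarrow> (\<exists>a b c. S = {a, b, c} \<and> a \<noteq> b \<and> b \<noteq> c \<and> a \<noteq> c \<and>
      S \<subseteq> V \<and> {a, b} \<in> E \<and> {b, c} \<in> E \<and> {a, c} \<in> E)"

definition is_quad :: "'a set \<Rightarrow> 'a set set \<Rightarrow> 'a set \<Rightarrow> bool" where
  "is_quad V E S \<longleftrightarrow> (\<exists>a b c d. S = {a, b, c, d} \<and> card S = 4 \<and> S \<subseteq> V \<and>
      {a, b} \<in> E \<and> {b, c} \<in> E \<and> {c, d} \<in> E \<and> {d, a} \<in> E)"

definition is_dense4 :: "'a set \<Rightarrow> 'a set set \<Rightarrow> 'a set \<Rightarrow> bool" where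
  "is_dense4 V E S \<longleftrightarrow> S \<subseteq> V \<and> card S = 4 \<and> card {e \<in> E. e \<subseteq> S} \<ge> 4"

end

theory Submission
  imports Defs "HOL-Library.Multiset"
begin

text \<open>
  Write \<open>K = n + r = 4r + 4s\<close>. Add missing edges one at a time: if \<open>G + xy\<close> has the desired packing,
  then \<open>G\<close> has it up to one damaged member, a triangle, a quadrilateral or \<open>D\<close>. Whenever the
  vertices outside a partial packing contain nonadjacent pairs, their degree sum \<open>K\<close> amounts to an
  average of four edges per pair and per member, with something to spare; so some member receives
  more than its share (typically nine edges from four vertices), and the few vertices involved can
  be repartitioned to advantage. This first restores \<open>r\<close> triangles and \<open>s - 1\<close> quadrilaterals and
  then increases the number of edges among the four remaining vertices: up to three edges the count
  works directly unless these form a star or a triangle, a star is first turned into a path or a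
  triangle, a path into a triangle or a quadrilateral, and for a triangle with an isolated vertex
  the latter is counted three times.
  The repartition statements concern at most ten vertices and are propositional: each lists the
  repartitions that together cover all cases, and is refuted by a SAT proof.
\<close>

section \<open>Repartitions of few vertices\<close>

definition c4 :: "('a \<Rightarrow> 'a \<Rightarrow> bool) \<Rightarrow> 'a \<Rightarrow> 'a \<Rightarrow> 'a \<Rightarrow> 'a \<Rightarrow> bool" where
  "c4 adj p q r s \<longleftrightarrow> adj p q \<and> adj q r \<and> adj r s \<and> adj s p"

definition tri :: "('a \<Rightarrow> 'a \<Rightarrow> bool) \<Rightarrow> 'a \<Rightarrow> 'a \<Rightarrow> 'a \<Rightarrow> bool" where
  "tri adj p q r \<longleftrightarrow> adj p q \<and> adj q r \<and> adj p r"

text \<open>Up to rotation and reflection four vertices have three cyclic orders, one per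
  disjunct.\<close>

definition has_c4 :: "('a \<Rightarrow> 'a \<Rightarrow> bool) \<Rightarrow> 'a \<Rightarrow> 'a \<Rightarrow> 'a \<Rightarrow> 'a \<Rightarrow> bool" where
  "has_c4 adj p q r s \<longleftrightarrow> c4 adj p q r s \<or> c4 adj p r q s \<or> c4 adj p q s r"

definition has_tri :: "('a \<Rightarrow> 'a \<Rightarrow> bool) \<Rightarrow> 'a \<Rightarrow> 'a \<Rightarrow> 'a \<Rightarrow> 'a \<Rightarrow> bool" where
  "has_tri adj p q r s \<longleftrightarrow> tri adj p q r \<or> tri adj p q s \<or> tri adj p r s \<or> tri adj q r s"

text \<open>A path on four vertices is a perfect matching, its two end edges, together with an edge
  joining them; each line treats one of the three matchings.\<close>

definition has_p4 :: "('a \<Rightarrow> 'a \<Rightarrow> bool) \<Rightarrow> 'a \<Rightarrow> 'a \<Rightarrow> 'a \<Rightarrow> 'a \<Rightarrow> bool" where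
  "has_p4 adj p q r s \<longleftrightarrow>
     adj p q \<and> adj r s \<and> (adj p r \<or> adj p s \<or> adj q r \<or> adj q s) \<or>
     adj p r \<and> adj q s \<and> (adj p q \<or> adj p s \<or> adj r q \<or> adj r s) \<or>
     adj p s \<and> adj q r \<and> (adj p q \<or> adj p r \<or> adj s q \<or> adj s r)"

text \<open>Counting is recursive so that for explicit lists and numbers it unfolds to a
  propositional formula.\<close>

fun at_least :: "nat \<Rightarrow> bool list \<Rightarrow> bool" where
  "at_least k [] \<longleftrightarrow> k = 0"
| "at_least k (b # bs) \<longleftrightarrow> k = 0 \<or> b \<and> at_least (k - 1) bs \<or> at_least k bs"

lemma at_least_iff: "at_least k bs \<longleftrightarrow> k \<le> (\<Sum>b\<leftarrow>bs. of_bool b)"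
  by (induction k bs rule: at_least.induct) (auto simp: of_bool_def)

definition edges4 :: "('a \<Rightarrow> 'a \<Rightarrow> bool) \<Rightarrow> 'a \<Rightarrow> 'a \<Rightarrow> 'a \<Rightarrow> 'a \<Rightarrow> bool list" where
  "edges4 adj p q r s = [adj p q, adj p r, adj p s, adj q r, adj q s, adj r s]"

text \<open>A vertex repeated in \<open>xs\<close> contributes its edges once per occurrence, which
  allows weighted counts.\<close>

definition pairs :: "('a \<Rightarrow> 'a \<Rightarrow> bool) \<Rightarrow> 'a list \<Rightarrow> 'a list \<Rightarrow> bool list" where
  "pairs adj xs ys = concat (map (\<lambda>x. map (adj x) ys) xs)"

text \<open>A cardinality hypothesis is handed to the propositional prover as a sequential counter:
  \<open>f i k\<close> stands for ``at least \<open>k\<close> of the booleans from position \<open>i\<close> on are true'', and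
  \<open>counter\<close> unfolds to the clauses linking neighbouring positions.\<close>

fun counter_step :: "(nat \<Rightarrow> nat \<Rightarrow> bool) \<Rightarrow> nat \<Rightarrow> bool \<Rightarrow> nat \<Rightarrow> bool" where
  "counter_step f i b 0 \<longleftrightarrow> True"
| "counter_step f i b (Suc j) \<longleftrightarrow>
     (f i (Suc j) \<longrightarrow> b \<and> f (Suc i) j \<or> f (Suc i) (Suc j)) \<and> counter_step f i b j"

lemma counter_step_numeral [simp]:
  "counter_step f i b (numeral n) \<longleftrightarrow>
     (f i (numeral n) \<longrightarrow> b \<and> f (Suc i) (pred_numeral n) \<or> f (Suc i) (numeral n)) \<and>
     counter_step f i b (pred_numeral n)"
  by (simp add: numeral_eq_Suc)

fun counter_end :: "(nat \<Rightarrow> bool) \<Rightarrow> nat \<Rightarrow> bool" where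
  "counter_end g 0 \<longleftrightarrow> True"
| "counter_end g (Suc j) \<longleftrightarrow> \<not> g (Suc j) \<and> counter_end g j"

lemma counter_end_numeral [simp]:
  "counter_end g (numeral n) \<longleftrightarrow> \<not> g (numeral n) \<and> counter_end g (pred_numeral n)"
  by (simp add: numeral_eq_Suc)

fun counter :: "(nat \<Rightarrow> nat \<Rightarrow> bool) \<Rightarrow> nat \<Rightarrow> nat \<Rightarrow> bool list \<Rightarrow> bool" where
  "counter f i k [] \<longleftrightarrow> counter_end (f i) k"
| "counter f i k (b # bs) \<longleftrightarrow> counter_step f i b k \<and> counter f (Suc i) k bs"

text \<open>The truth values of \<open>at_least j (drop i bs)\<close> satisfy all clauses. Naming
  them avoids the large expansion of \<open>at_least\<close> on lists of up to 24 entries.\<close>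

lemma at_least_counter:
  assumes "at_least k bs"
  obtains f where "f 0 k" "counter f 0 k bs"
proof -
  let ?f = "\<lambda>i j. at_least j (drop i bs)"
  have step: "counter_step ?f i b k" if "drop i bs = b # cs" for i b cs
  proof -
    from that have "drop (Suc i) bs = cs" by (metis drop_Suc list.sel(3) tl_drop)
    with that show ?thesis by (induction k) auto
  qed
  have last: "counter_end (\<lambda>j. j = 0) k" by (induction k) auto
  have "counter ?f i k cs" if "drop i bs = cs" for i cs
    using that
  proof (induction cs arbitrary: i)
    case (Cons c cs)
    then have "drop (Suc i) bs = cs" by (metis drop_Suc list.sel(3) tl_drop)
    with Cons step show ?case by simp
  qed (simp add: last)
  from this[of 0 bs] show ?thesis using that[of ?f] assms by simp
qed

lemmas shape_defs = c4_def tri_def has_c4_def has_tri_def has_p4_def edges4_def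

section \<open>A triangle and four leftover vertices\<close>

text \<open>At least five of the edges end in \<open>t1\<close> or \<open>t2\<close>, so some
  outside vertex is adjacent to both and can replace \<open>t3\<close>. If \<open>t3\<close> has a
  single outside neighbour, all four vertices are adjacent to \<open>t1\<close> and
  \<open>t2\<close>, and the replacement can avoid that neighbour.\<close>

lemma tri_edges_0:
  assumes sym: "\<And>x y. adj x y = adj y x"
    and base: "tri adj t1 t2 t3"
    and cross: "at_least 9 (pairs adj [a, b, c, d] [t1, t2, t3])"
  shows "\<exists>p q r s t u v.
    mset [p, q, r, s, t, u, v] = mset [t1, t2, t3, a, b, c, d] \<and>
    tri adj p q r \<and> at_least 1 (edges4 adj s t u v)"
proof (rule ccontr)
  assume "\<not> ?thesis"
  then have H: "\<not> (tri adj p q r \<and> at_least 1 (edges4 adj s t u v))"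
    if "mset [p, q, r, s, t, u, v] = mset [t1, t2, t3, a, b, c, d]" for p q r s t u v
    using that by blast
  obtain f where f: "f 0 9" "counter f 0 9 (pairs adj [a, b, c, d] [t1, t2, t3])"
    using cross by (rule at_least_counter)
  note splits =
    H[of t1 t2 a t3 b c d] H[of t1 t2 b t3 a c d] H[of t1 t2 c t3 a b d] H[of t1 t2 d t3 a b c]
  note [simp] = shape_defs pairs_def sym base[unfolded shape_defs, simplified sym]
  from splits[simplified] f[simplified]
  show False by sat
qed

lemma tri_edges_1:
  assumes sym: "\<And>x y. adj x y = adj y x"
    and base: "tri adj t1 t2 t3"
    and cross: "at_least 9 (pairs adj [a, b, c, d] [t1, t2, t3])"
    and edges: "at_least 1 (edges4 adj a b c d)"
  shows "\<exists>p q r s t u v.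
    mset [p, q, r, s, t, u, v] = mset [t1, t2, t3, a, b, c, d] \<and>
    tri adj p q r \<and> at_least 2 (edges4 adj s t u v)"
proof (rule ccontr)
  assume "\<not> ?thesis"
  then have H: "\<not> (tri adj p q r \<and> at_least 2 (edges4 adj s t u v))"
    if "mset [p, q, r, s, t, u, v] = mset [t1, t2, t3, a, b, c, d]" for p q r s t u v
    using that by blast
  obtain f where f: "f 0 9" "counter f 0 9 (pairs adj [a, b, c, d] [t1, t2, t3])"
    using cross by (rule at_least_counter)
  note splits =
    H[of t1 t2 a t3 b c d] H[of t1 t2 b t3 a c d] H[of t1 t2 c t3 a b d] H[of t1 t2 d t3 a b c]
  note [simp] = shape_defs pairs_def sym base[unfolded shape_defs, simplified sym]
  from splits[simplified] f[simplified] edges[simplified]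
  show False by sat
qed

lemma tri_edges_2:
  assumes sym: "\<And>x y. adj x y = adj y x"
    and base: "tri adj t1 t2 t3"
    and cross: "at_least 9 (pairs adj [a, b, c, d] [t1, t2, t3])"
    and edges: "at_least 2 (edges4 adj a b c d)"
  shows "\<exists>p q r s t u v.
    mset [p, q, r, s, t, u, v] = mset [t1, t2, t3, a, b, c, d] \<and>
    tri adj p q r \<and> at_least 3 (edges4 adj s t u v)"
proof (rule ccontr)
  assume "\<not> ?thesis"
  then have H: "\<not> (tri adj p q r \<and> at_least 3 (edges4 adj s t u v))"
    if "mset [p, q, r, s, t, u, v] = mset [t1, t2, t3, a, b, c, d]" for p q r s t u v
    using that by blast
  obtain f where f: "f 0 9" "counter f 0 9 (pairs adj [a, b, c, d] [t1, t2, t3])"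
    using cross by (rule at_least_counter)
  note splits =
    H[of t1 t2 a t3 b c d] H[of t1 t2 b t3 a c d] H[of t1 t2 c t3 a b d] H[of t1 t2 d t3 a b c]
    H[of t1 t3 a t2 b c d] H[of t1 t3 b t2 a c d] H[of t1 t3 c t2 a b d] H[of t1 t3 d t2 a b c]
  note [simp] = shape_defs pairs_def sym base[unfolded shape_defs, simplified sym]
  from splits[simplified] f[simplified] edges[simplified]
  show False by sat
qed

text \<open>The path is cut into its end edges: one forms a triangle with \<open>t1\<close> or
  \<open>t2\<close>, the other is joined to the remaining side of the triangle by two edges, which
  close a triangle or a quadrilateral.\<close>

lemma tri_path4:
  assumes sym: "\<And>x y. adj x y = adj y x"
    and base: "tri adj t1 t2 t3" "adj a b" "adj b c" "adj c d"
    and cross: "at_least 9 (pairs adj [a, b, c, d] [t1, t2, t3])"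
  shows "\<exists>p q r s t u v.
    mset [p, q, r, s, t, u, v] = mset [t1, t2, t3, a, b, c, d] \<and>
    tri adj p q r \<and> (has_c4 adj s t u v \<or> has_tri adj s t u v)"
proof (rule ccontr)
  assume "\<not> ?thesis"
  then have H: "\<not> (tri adj p q r \<and> (has_c4 adj s t u v \<or> has_tri adj s t u v))"
    if "mset [p, q, r, s, t, u, v] = mset [t1, t2, t3, a, b, c, d]" for p q r s t u v
    using that by blast
  obtain f where f: "f 0 9" "counter f 0 9 (pairs adj [a, b, c, d] [t1, t2, t3])"
    using cross by (rule at_least_counter)
  note splits =
    H[of t1 a b t2 t3 c d] H[of t1 c d t2 t3 a b] H[of t2 a b t1 t3 c d] H[of t2 c d t1 t3 a b]
  note [simp] = shape_defs pairs_def sym base[unfolded shape_defs, simplified sym]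
  from splits[simplified] f[simplified]
  show False by sat
qed

text \<open>A leaf adjacent to \<open>t1\<close> and \<open>t2\<close> changes places with
  \<open>t3\<close>, and an edge from \<open>t3\<close> to another leaf prolongs the rest of the
  star to a path.\<close>

lemma tri_star:
  assumes sym: "\<And>x y. adj x y = adj y x"
    and base: "tri adj t1 t2 t3" "adj a b" "adj a c" "adj a d"
    and cross: "at_least 7 (pairs adj [b, c, d] [t1, t2, t3])"
  shows "\<exists>p q r s t u v.
    mset [p, q, r, s, t, u, v] = mset [t1, t2, t3, a, b, c, d] \<and>
    tri adj p q r \<and> (has_p4 adj s t u v \<or> has_tri adj s t u v)"
proof (rule ccontr)
  assume "\<not> ?thesis"
  then have H: "\<not> (tri adj p q r \<and> (has_p4 adj s t u v \<or> has_tri adj s t u v))"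
    if "mset [p, q, r, s, t, u, v] = mset [t1, t2, t3, a, b, c, d]" for p q r s t u v
    using that by blast
  obtain f where f: "f 0 7" "counter f 0 7 (pairs adj [b, c, d] [t1, t2, t3])"
    using cross by (rule at_least_counter)
  note splits =
    H[of t1 t2 b t3 a c d] H[of t1 t2 c t3 a b d] H[of t1 t2 d t3 a b c]
  note [simp] = shape_defs pairs_def sym base[unfolded shape_defs, simplified sym]
  from splits[simplified] f[simplified]
  show False by sat
qed

section \<open>A quadrilateral and four leftover vertices\<close>

text \<open>Some outside vertex has three neighbours on the quadrilateral, hence two opposite ones,
  and can replace either of the other two vertices. All sixteen exchanges of one vertex are
  listed.\<close>

lemma quad_edges_0:
  assumes sym: "\<And>x y. adj x y = adj y x"
    and base: "c4 adj q1 q2 q3 q4"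
    and cross: "at_least 9 (pairs adj [a, b, c, d] [q1, q2, q3, q4])"
  shows "\<exists>p q r s t u v w.
    mset [p, q, r, s, t, u, v, w] = mset [q1, q2, q3, q4, a, b, c, d] \<and>
    has_c4 adj p q r s \<and> at_least 1 (edges4 adj t u v w)"
proof (rule ccontr)
  assume "\<not> ?thesis"
  then have H: "\<not> (has_c4 adj p q r s \<and> at_least 1 (edges4 adj t u v w))"
    if "mset [p, q, r, s, t, u, v, w] = mset [q1, q2, q3, q4, a, b, c, d]" for p q r s t u v w
    using that by blast
  obtain f where f: "f 0 9" "counter f 0 9 (pairs adj [a, b, c, d] [q1, q2, q3, q4])"
    using cross by (rule at_least_counter)
  note splits =
    H[of q1 q2 q3 a q4 b c d] H[of q1 q2 q4 a q3 b c d] H[of q1 q3 q4 b q2 a c d]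
    H[of q2 q3 q4 b q1 a c d] H[of q1 q2 q3 c q4 a b d] H[of q1 q2 q4 c q3 a b d]
    H[of q1 q3 q4 d q2 a b c] H[of q2 q3 q4 d q1 a b c] H[of q1 q2 q3 b q4 a c d]
    H[of q1 q2 q4 d q3 a b c] H[of q1 q3 q4 a q2 b c d] H[of q2 q3 q4 c q1 a b d]
    H[of q1 q2 q3 d q4 a b c] H[of q1 q2 q4 b q3 a c d] H[of q1 q3 q4 c q2 a b d]
    H[of q2 q3 q4 a q1 b c d]
  note [simp] = shape_defs pairs_def sym base[unfolded shape_defs, simplified sym]
  from splits[simplified] f[simplified]
  show False by sat
qed

lemma quad_edges_1:
  assumes sym: "\<And>x y. adj x y = adj y x"
    and base: "c4 adj q1 q2 q3 q4"
    and cross: "at_least 9 (pairs adj [a, b, c, d] [q1, q2, q3, q4])"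
    and edges: "at_least 1 (edges4 adj a b c d)"
  shows "\<exists>p q r s t u v w.
    mset [p, q, r, s, t, u, v, w] = mset [q1, q2, q3, q4, a, b, c, d] \<and>
    has_c4 adj p q r s \<and> at_least 2 (edges4 adj t u v w)"
proof (rule ccontr)
  assume "\<not> ?thesis"
  then have H: "\<not> (has_c4 adj p q r s \<and> at_least 2 (edges4 adj t u v w))"
    if "mset [p, q, r, s, t, u, v, w] = mset [q1, q2, q3, q4, a, b, c, d]" for p q r s t u v w
    using that by blast
  obtain f where f: "f 0 9" "counter f 0 9 (pairs adj [a, b, c, d] [q1, q2, q3, q4])"
    using cross by (rule at_least_counter)
  note splits =
    H[of q1 q2 q3 a q4 b c d] H[of q1 q3 q4 b q2 a c d] H[of q1 q2 q3 c q4 a b d]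
    H[of q1 q3 q4 d q2 a b c] H[of q1 q2 q4 a q3 b c d] H[of q2 q3 q4 b q1 a c d]
    H[of q1 q2 q4 d q3 a b c] H[of q2 q3 q4 c q1 a b d] H[of q1 q2 q3 b q4 a c d]
    H[of q1 q3 q4 a q2 b c d] H[of q1 q2 q4 c q3 a b d] H[of q2 q3 q4 d q1 a b c]
    H[of q1 q2 q3 d q4 a b c] H[of q1 q3 q4 c q2 a b d] H[of q1 q2 q4 b q3 a c d]
    H[of q2 q3 q4 a q1 b c d] H[of q1 q2 a b q3 q4 c d] H[of q1 q2 a c q3 q4 b d]
    H[of q1 q2 a d q3 q4 b c] H[of q1 q2 b c q3 q4 a d] H[of q1 q2 b d q3 q4 a c]
    H[of q1 q2 c d q3 q4 a b] H[of q3 q4 a b q1 q2 c d] H[of q3 q4 a c q1 q2 b d]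
    H[of q3 q4 a d q1 q2 b c] H[of q3 q4 b c q1 q2 a d] H[of q3 q4 b d q1 q2 a c]
    H[of q3 q4 c d q1 q2 a b]
  note [simp] = shape_defs pairs_def sym base[unfolded shape_defs, simplified sym]
  from splits[simplified] f[simplified] edges[simplified]
  show False by sat
qed

text \<open>Vertices are exchanged singly, in pairs along a side, or in threes when three of
  \<open>a\<close>, \<open>b\<close>, \<open>c\<close>, \<open>d\<close> close a quadrilateral with
  \<open>q1\<close> or \<open>q2\<close>.\<close>

lemma quad_edges_2:
  assumes sym: "\<And>x y. adj x y = adj y x"
    and base: "c4 adj q1 q2 q3 q4"
    and cross: "at_least 9 (pairs adj [a, b, c, d] [q1, q2, q3, q4])"
    and edges: "at_least 2 (edges4 adj a b c d)"
  shows "\<exists>p q r s t u v w.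
    mset [p, q, r, s, t, u, v, w] = mset [q1, q2, q3, q4, a, b, c, d] \<and>
    has_c4 adj p q r s \<and> at_least 3 (edges4 adj t u v w)"
proof (rule ccontr)
  assume "\<not> ?thesis"
  then have H: "\<not> (has_c4 adj p q r s \<and> at_least 3 (edges4 adj t u v w))"
    if "mset [p, q, r, s, t, u, v, w] = mset [q1, q2, q3, q4, a, b, c, d]" for p q r s t u v w
    using that by blast
  obtain f where f: "f 0 9" "counter f 0 9 (pairs adj [a, b, c, d] [q1, q2, q3, q4])"
    using cross by (rule at_least_counter)
  note splits =
    H[of q1 q2 a b q3 q4 c d] H[of q1 q2 c d q3 q4 a b] H[of q3 q4 a c q1 q2 b d]
    H[of q3 q4 b d q1 q2 a c] H[of q1 q2 a d q3 q4 b c] H[of q1 q2 b c q3 q4 a d]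
    H[of q3 q4 a b q1 q2 c d] H[of q3 q4 c d q1 q2 a b] H[of q1 q2 a c q3 q4 b d]
    H[of q1 q2 b d q3 q4 a c] H[of q3 q4 a d q1 q2 b c] H[of q3 q4 b c q1 q2 a d]
    H[of q1 q2 q3 a q4 b c d] H[of q1 q2 q4 a q3 b c d] H[of q1 q3 q4 b q2 a c d]
    H[of q2 q3 q4 b q1 a c d] H[of q1 q2 q3 c q4 a b d] H[of q1 q3 q4 d q2 a b c]
    H[of q1 q2 q4 c q3 a b d] H[of q2 q3 q4 d q1 a b c] H[of q1 q4 a b q2 q3 c d]
    H[of q1 q4 c d q2 q3 a b] H[of q2 q3 a b q1 q4 c d] H[of q2 q3 c d q1 q4 a b]
    H[of q1 q2 q3 b q4 a c d] H[of q1 q2 q4 b q3 a c d] H[of q1 q3 q4 a q2 b c d]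
    H[of q2 q3 q4 a q1 b c d] H[of q1 q2 q3 d q4 a b c] H[of q1 q2 q4 d q3 a b c]
    H[of q1 q3 q4 c q2 a b d] H[of q2 q3 q4 c q1 a b d] H[of q1 a b c q2 q3 q4 d]
    H[of q1 a b d q2 q3 q4 c] H[of q1 a c d q2 q3 q4 b] H[of q1 b c d q2 q3 q4 a]
    H[of q2 a b c q1 q3 q4 d] H[of q2 a b d q1 q3 q4 c] H[of q2 a c d q1 q3 q4 b]
    H[of q2 b c d q1 q3 q4 a]
  note [simp] = shape_defs pairs_def sym base[unfolded shape_defs, simplified sym]
  from splits[simplified] f[simplified] edges[simplified]
  show False by sat
qed

text \<open>Either the path is split into two pairs that are combined with opposite sides of the
  quadrilateral, or an end of the path changes places with a vertex of the quadrilateral.\<close>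

lemma quad_path4:
  assumes sym: "\<And>x y. adj x y = adj y x"
    and base: "c4 adj q1 q2 q3 q4" "adj a b" "adj b c" "adj c d"
    and cross: "at_least 9 (pairs adj [a, b, c, d] [q1, q2, q3, q4])"
  shows "\<exists>p q r s t u v w.
    mset [p, q, r, s, t, u, v, w] = mset [q1, q2, q3, q4, a, b, c, d] \<and>
    has_c4 adj p q r s \<and> (has_c4 adj t u v w \<or> has_tri adj t u v w)"
proof (rule ccontr)
  assume "\<not> ?thesis"
  then have H: "\<not> (has_c4 adj p q r s \<and> (has_c4 adj t u v w \<or> has_tri adj t u v w))"
    if "mset [p, q, r, s, t, u, v, w] = mset [q1, q2, q3, q4, a, b, c, d]" for p q r s t u v w
    using that by blast
  obtain f where f: "f 0 9" "counter f 0 9 (pairs adj [a, b, c, d] [q1, q2, q3, q4])"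
    using cross by (rule at_least_counter)
  note splits =
    H[of q1 q2 a b q3 q4 c d] H[of q1 q2 c d q3 q4 a b] H[of q3 q4 a b q1 q2 c d]
    H[of q3 q4 c d q1 q2 a b] H[of q1 q4 a b q2 q3 c d] H[of q2 q3 a b q1 q4 c d]
    H[of q1 q4 c d q2 q3 a b] H[of q2 q3 c d q1 q4 a b] H[of q1 q2 b c q3 q4 a d]
    H[of q3 q4 b c q1 q2 a d] H[of q1 q2 q3 a q4 b c d] H[of q1 q2 q4 a q3 b c d]
    H[of q1 q3 q4 d q2 a b c] H[of q2 q3 q4 d q1 a b c] H[of q1 q4 b c q2 q3 a d]
    H[of q2 q3 b c q1 q4 a d] H[of q1 q2 q3 d q4 a b c] H[of q1 q2 q4 d q3 a b c]
    H[of q1 q3 q4 a q2 b c d] H[of q2 q3 q4 a q1 b c d]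
  note [simp] = shape_defs pairs_def sym base[unfolded shape_defs, simplified sym]
  from splits[simplified] f[simplified]
  show False by sat
qed

text \<open>Either a leaf enters the quadrilateral in exchange for a vertex of it, or the centre and
  two leaves close a quadrilateral with one of its vertices and the third leaf joins the other
  three.\<close>

lemma quad_star:
  assumes sym: "\<And>x y. adj x y = adj y x"
    and base: "c4 adj q1 q2 q3 q4" "adj a b" "adj a c" "adj a d"
    and cross: "at_least 7 (pairs adj [b, c, d] [q1, q2, q3, q4])"
  shows "\<exists>p q r s t u v w.
    mset [p, q, r, s, t, u, v, w] = mset [q1, q2, q3, q4, a, b, c, d] \<and>
    has_c4 adj p q r s \<and> (has_p4 adj t u v w \<or> has_tri adj t u v w)"
proof (rule ccontr)
  assume "\<not> ?thesis"
  then have H: "\<not> (has_c4 adj p q r s \<and> (has_p4 adj t u v w \<or> has_tri adj t u v w))"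
    if "mset [p, q, r, s, t, u, v, w] = mset [q1, q2, q3, q4, a, b, c, d]" for p q r s t u v w
    using that by blast
  obtain f where f: "f 0 7" "counter f 0 7 (pairs adj [b, c, d] [q1, q2, q3, q4])"
    using cross by (rule at_least_counter)
  note splits =
    H[of q1 q2 q3 b q4 a c d] H[of q1 q2 q4 b q3 a c d] H[of q1 a c d q2 q3 q4 b]
    H[of q2 a c d q1 q3 q4 b] H[of q3 a c d q1 q2 q4 b] H[of q4 a c d q1 q2 q3 b]
    H[of q1 q3 q4 c q2 a b d] H[of q1 q3 q4 d q2 a b c] H[of q2 q3 q4 c q1 a b d]
    H[of q2 q3 q4 d q1 a b c]
  note [simp] = shape_defs pairs_def sym base[unfolded shape_defs, simplified sym]
  from splits[simplified] f[simplified]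
  show False by sat
qed

text \<open>The repeated vertex \<open>a\<close> gives it weight 3 in the count.\<close>

lemma quad_triangle:
  assumes sym: "\<And>x y. adj x y = adj y x"
    and base: "c4 adj q1 q2 q3 q4" "tri adj b c d"
    and cross: "at_least 13 (pairs adj [a, a, a, b, c, d] [q1, q2, q3, q4])"
  shows "\<exists>p q r s t u v w.
    mset [p, q, r, s, t, u, v, w] = mset [q1, q2, q3, q4, a, b, c, d] \<and>
    has_c4 adj p q r s \<and> at_least 4 (edges4 adj t u v w)"
proof (rule ccontr)
  assume "\<not> ?thesis"
  then have H: "\<not> (has_c4 adj p q r s \<and> at_least 4 (edges4 adj t u v w))"
    if "mset [p, q, r, s, t, u, v, w] = mset [q1, q2, q3, q4, a, b, c, d]" for p q r s t u v w
    using that by blast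
  obtain f where f: "f 0 13" "counter f 0 13 (pairs adj [a, a, a, b, c, d] [q1, q2, q3, q4])"
    using cross by (rule at_least_counter)
  note splits =
    H[of q1 b c d q2 q3 q4 a] H[of q2 b c d q1 q3 q4 a] H[of q3 b c d q1 q2 q4 a]
    H[of q4 b c d q1 q2 q3 a] H[of q1 q2 q3 a q4 b c d] H[of q1 q2 q4 a q3 b c d]
    H[of q1 q2 b c q3 q4 a d] H[of q3 q4 b c q1 q2 a d] H[of q1 q2 b d q3 q4 a c]
    H[of q3 q4 b d q1 q2 a c] H[of q1 q2 c d q3 q4 a b] H[of q3 q4 c d q1 q2 a b]
    H[of q1 q3 q4 a q2 b c d] H[of q1 q2 q3 b q4 a c d] H[of q1 q2 q3 c q4 a b d]
    H[of q1 q2 q3 d q4 a b c] H[of q1 q3 q4 b q2 a c d] H[of q1 q2 q4 b q3 a c d]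
    H[of q2 q3 q4 b q1 a c d] H[of q1 q2 q4 c q3 a b d] H[of q1 q2 q4 d q3 a b c]
    H[of q2 q3 q4 a q1 b c d] H[of q2 q3 q4 c q1 a b d] H[of q2 q3 q4 d q1 a b c]
    H[of q1 q3 q4 c q2 a b d] H[of q1 q3 q4 d q2 a b c]
  note [simp] = shape_defs pairs_def sym base[unfolded shape_defs, simplified sym]
  from splits[simplified] f[simplified]
  show False by sat
qed

section \<open>Members of the packing against each other\<close>

text \<open>Serves to gain a triangle: both quadrilaterals are cut into opposite sides and
  recombined, or one vertex of each is exchanged.\<close>

lemma quad_quad:
  assumes sym: "\<And>x y. adj x y = adj y x"
    and base: "c4 adj p1 p2 p3 p4" "c4 adj q1 q2 q3 q4"
    and cross: "at_least 9 (pairs adj [q1, q2, q3, q4] [p1, p2, p3, p4])"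
  shows "\<exists>p q r s t u v w.
    mset [p, q, r, s, t, u, v, w] = mset [p1, p2, p3, p4, q1, q2, q3, q4] \<and>
    has_c4 adj p q r s \<and> has_tri adj t u v w"
proof (rule ccontr)
  assume "\<not> ?thesis"
  then have H: "\<not> (has_c4 adj p q r s \<and> has_tri adj t u v w)"
    if "mset [p, q, r, s, t, u, v, w] = mset [p1, p2, p3, p4, q1, q2, q3, q4]" for p q r s t u v w
    using that by blast
  obtain f where f: "f 0 9" "counter f 0 9 (pairs adj [q1, q2, q3, q4] [p1, p2, p3, p4])"
    using cross by (rule at_least_counter)
  note splits =
    H[of p1 p2 q1 q2 p3 p4 q3 q4] H[of p1 p2 q3 q4 p3 p4 q1 q2] H[of p3 p4 q1 q2 p1 p2 q3 q4]
    H[of p3 p4 q3 q4 p1 p2 q1 q2] H[of p1 p4 q1 q4 p2 p3 q2 q3] H[of p1 p4 q2 q3 p2 p3 q1 q4]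
    H[of p2 p3 q1 q4 p1 p4 q2 q3] H[of p2 p3 q2 q3 p1 p4 q1 q4] H[of p1 p2 q1 q4 p3 p4 q2 q3]
    H[of p1 p2 q2 q3 p3 p4 q1 q4] H[of p3 p4 q1 q4 p1 p2 q2 q3] H[of p3 p4 q2 q3 p1 p2 q1 q4]
    H[of p1 p2 p3 q1 p4 q2 q3 q4] H[of p1 p2 p3 q2 p4 q1 q3 q4] H[of p1 p2 p4 q1 p3 q2 q3 q4]
    H[of p1 p2 p4 q2 p3 q1 q3 q4] H[of p1 p3 p4 q1 p2 q2 q3 q4] H[of p1 p3 p4 q2 p2 q1 q3 q4]
    H[of p2 p3 p4 q1 p1 q2 q3 q4] H[of p2 p3 p4 q2 p1 q1 q3 q4]
  note [simp] = shape_defs pairs_def sym base[unfolded shape_defs, simplified sym]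
  from splits[simplified] f[simplified]
  show False by sat
qed

text \<open>Serves to gain a triangle: the quadrilateral is cut into opposite sides, one of which
  forms a triangle with a vertex of the given triangle while the other two triangle vertices join
  the second side.\<close>

lemma tri_quad:
  assumes sym: "\<And>x y. adj x y = adj y x"
    and base: "tri adj t1 t2 t3" "c4 adj q1 q2 q3 q4"
    and cross: "at_least 9 (pairs adj [q1, q2, q3, q4] [t1, t2, t3])"
  shows "\<exists>p q r s t u v.
    mset [p, q, r, s, t, u, v] = mset [t1, t2, t3, q1, q2, q3, q4] \<and>
    tri adj p q r \<and> has_tri adj s t u v"
proof (rule ccontr)
  assume "\<not> ?thesis"
  then have H: "\<not> (tri adj p q r \<and> has_tri adj s t u v)"
    if "mset [p, q, r, s, t, u, v] = mset [t1, t2, t3, q1, q2, q3, q4]" for p q r s t u v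
    using that by blast
  obtain f where f: "f 0 9" "counter f 0 9 (pairs adj [q1, q2, q3, q4] [t1, t2, t3])"
    using cross by (rule at_least_counter)
  note splits =
    H[of t1 q1 q2 t2 t3 q3 q4] H[of t1 q3 q4 t2 t3 q1 q2] H[of t2 q1 q4 t1 t3 q2 q3]
    H[of t2 q2 q3 t1 t3 q1 q4]
  note [simp] = shape_defs pairs_def sym base[unfolded shape_defs, simplified sym]
  from splits[simplified] f[simplified]
  show False by sat
qed

text \<open>Two edges from a common vertex close a quadrilateral with the other triangle; two
  disjoint edges close one with a side of each triangle.\<close>

lemma tri_tri:
  assumes sym: "\<And>x y. adj x y = adj y x"
    and base: "tri adj t1 t2 t3" "tri adj u1 u2 u3"
    and cross: "at_least 2 (pairs adj [t1, t2, t3] [u1, u2, u3])"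
  shows "\<exists>p q r s t u.
    mset [p, q, r, s, t, u] = mset [t1, t2, t3, u1, u2, u3] \<and>
    has_c4 adj p q r s"
proof (rule ccontr)
  assume "\<not> ?thesis"
  then have H: "\<not> (has_c4 adj p q r s)"
    if "mset [p, q, r, s, t, u] = mset [t1, t2, t3, u1, u2, u3]" for p q r s t u
    using that by blast
  obtain f where f: "f 0 2" "counter f 0 2 (pairs adj [t1, t2, t3] [u1, u2, u3])"
    using cross by (rule at_least_counter)
  note splits =
    H[of t1 t2 u1 u2 t3 u3] H[of t1 t2 u1 u3 t3 u2] H[of t1 t2 u2 u3 t3 u1]
    H[of t1 t3 u1 u2 t2 u3] H[of t1 t3 u1 u3 t2 u2] H[of t1 t3 u2 u3 t2 u1]
    H[of t2 t3 u1 u2 t1 u3] H[of t2 t3 u1 u3 t1 u2] H[of t2 t3 u2 u3 t1 u1]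
    H[of t1 u1 u2 u3 t2 t3] H[of t2 u1 u2 u3 t1 t3] H[of t3 u1 u2 u3 t1 t2]
    H[of t1 t2 t3 u1 u2 u3] H[of t1 t2 t3 u2 u1 u3] H[of t1 t2 t3 u3 u1 u2]
  note [simp] = shape_defs pairs_def sym base[unfolded shape_defs, simplified sym]
  from splits[simplified] f[simplified]
  show False by sat
qed

text \<open>A vertex \<open>qi\<close> with two neighbours on a triangle closes a quadrilateral with
  it. Seven edges provide two such vertices for the first triangle, five provide one for the second,
  so different ones can be chosen.\<close>

lemma tri_tri_quad_7_5:
  assumes sym: "\<And>x y. adj x y = adj y x"
    and base: "tri adj t1 t2 t3" "tri adj u1 u2 u3" "c4 adj q1 q2 q3 q4"
    and cross1: "at_least 7 (pairs adj [t1, t2, t3] [q1, q2, q3, q4])"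
    and cross2: "at_least 5 (pairs adj [u1, u2, u3] [q1, q2, q3, q4])"
  shows "\<exists>p q r s t u v w x y.
    mset [p, q, r, s, t, u, v, w, x, y] = mset [t1, t2, t3, u1, u2, u3, q1, q2, q3, q4] \<and>
    has_c4 adj p q r s \<and> has_c4 adj t u v w"
proof (rule ccontr)
  assume "\<not> ?thesis"
  then have H: "\<not> (has_c4 adj p q r s \<and> has_c4 adj t u v w)"
    if "mset [p, q, r, s, t, u, v, w, x, y] = mset [t1, t2, t3, u1, u2, u3, q1, q2, q3, q4]" for p q r s t u v w x y
    using that by blast
  obtain f where f: "f 0 7" "counter f 0 7 (pairs adj [t1, t2, t3] [q1, q2, q3, q4])"
    using cross1 by (rule at_least_counter)
  obtain g where g: "g 0 5" "counter g 0 5 (pairs adj [u1, u2, u3] [q1, q2, q3, q4])"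
    using cross2 by (rule at_least_counter)
  note splits =
    H[of q1 t1 t2 t3 q2 u1 u2 u3 q3 q4] H[of q1 t1 t2 t3 q3 u1 u2 u3 q2 q4]
    H[of q1 t1 t2 t3 q4 u1 u2 u3 q2 q3] H[of q2 t1 t2 t3 q1 u1 u2 u3 q3 q4]
    H[of q2 t1 t2 t3 q3 u1 u2 u3 q1 q4] H[of q2 t1 t2 t3 q4 u1 u2 u3 q1 q3]
    H[of q3 t1 t2 t3 q1 u1 u2 u3 q2 q4] H[of q3 t1 t2 t3 q2 u1 u2 u3 q1 q4]
    H[of q3 t1 t2 t3 q4 u1 u2 u3 q1 q2] H[of q4 t1 t2 t3 q1 u1 u2 u3 q2 q3]
    H[of q4 t1 t2 t3 q2 u1 u2 u3 q1 q3] H[of q4 t1 t2 t3 q3 u1 u2 u3 q1 q2]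
  note [simp] = shape_defs pairs_def sym base[unfolded shape_defs, simplified sym]
  from splits[simplified] f[simplified] g[simplified]
  show False by sat
qed

text \<open>With eleven edges every \<open>qi\<close> closes a quadrilateral with the first
  triangle. If no \<open>qi\<close> does so with the second, its edges end in three different
  \<open>qi\<close>, and a quadrilateral arises from two adjacent ones and two of the
  \<open>ui\<close>, or from three of them and one \<open>ui\<close>.\<close>

lemma tri_tri_quad_11_3:
  assumes sym: "\<And>x y. adj x y = adj y x"
    and base: "tri adj t1 t2 t3" "tri adj u1 u2 u3" "c4 adj q1 q2 q3 q4"
    and cross1: "at_least 11 (pairs adj [t1, t2, t3] [q1, q2, q3, q4])"
    and cross2: "at_least 3 (pairs adj [u1, u2, u3] [q1, q2, q3, q4])"
  shows "\<exists>p q r s t u v w x y.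
    mset [p, q, r, s, t, u, v, w, x, y] = mset [t1, t2, t3, u1, u2, u3, q1, q2, q3, q4] \<and>
    has_c4 adj p q r s \<and> has_c4 adj t u v w"
proof (rule ccontr)
  assume "\<not> ?thesis"
  then have H: "\<not> (has_c4 adj p q r s \<and> has_c4 adj t u v w)"
    if "mset [p, q, r, s, t, u, v, w, x, y] = mset [t1, t2, t3, u1, u2, u3, q1, q2, q3, q4]" for p q r s t u v w x y
    using that by blast
  obtain f where f: "f 0 11" "counter f 0 11 (pairs adj [t1, t2, t3] [q1, q2, q3, q4])"
    using cross1 by (rule at_least_counter)
  obtain g where g: "g 0 3" "counter g 0 3 (pairs adj [u1, u2, u3] [q1, q2, q3, q4])"
    using cross2 by (rule at_least_counter)
  note splits =
    H[of q2 t1 t2 t3 q1 u1 u2 u3 q3 q4] H[of q3 t1 t2 t3 q2 u1 u2 u3 q1 q4]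
    H[of q4 t1 t2 t3 q3 u1 u2 u3 q1 q2] H[of q1 t1 t2 t3 q4 u1 u2 u3 q2 q3]
    H[of q3 t1 t2 t3 u1 u2 q1 q2 u3 q4] H[of q3 t1 t2 t3 u1 u3 q1 q2 u2 q4]
    H[of q3 t1 t2 t3 u2 u3 q1 q2 u1 q4] H[of q4 t1 t2 t3 u1 u2 q2 q3 u3 q1]
    H[of q4 t1 t2 t3 u1 u3 q2 q3 u2 q1] H[of q4 t1 t2 t3 u2 u3 q2 q3 u1 q1]
    H[of q1 t1 t2 t3 u1 u2 q3 q4 u3 q2] H[of q1 t1 t2 t3 u1 u3 q3 q4 u2 q2]
    H[of q1 t1 t2 t3 u2 u3 q3 q4 u1 q2] H[of q2 t1 t2 t3 u1 u2 q4 q1 u3 q3]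
    H[of q2 t1 t2 t3 u1 u3 q4 q1 u2 q3] H[of q2 t1 t2 t3 u2 u3 q4 q1 u1 q3]
    H[of q1 t1 t2 t3 u1 q2 q3 q4 u2 u3] H[of q1 t1 t2 t3 u2 q2 q3 q4 u1 u3]
    H[of q1 t1 t2 t3 u3 q2 q3 q4 u1 u2] H[of q2 t1 t2 t3 u1 q3 q4 q1 u2 u3]
    H[of q2 t1 t2 t3 u2 q3 q4 q1 u1 u3] H[of q2 t1 t2 t3 u3 q3 q4 q1 u1 u2]
  note [simp] = shape_defs pairs_def sym base[unfolded shape_defs, simplified sym]
  from splits[simplified] f[simplified] g[simplified]
  show False by sat
qed

lemma tri_edges:
  assumes "\<And>x y. adj x y = adj y x" "tri adj t1 t2 t3"
    and "at_least 9 (pairs adj [a, b, c, d] [t1, t2, t3])"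
    and "at_least k (edges4 adj a b c d)" "k \<le> 2"
  shows "\<exists>p q r s t u v.
    mset [p, q, r, s, t, u, v] = mset [t1, t2, t3, a, b, c, d] \<and>
    tri adj p q r \<and> at_least (Suc k) (edges4 adj s t u v)"
proof -
  have nums: "Suc 0 = 1" "Suc 1 = 2" "Suc 2 = 3" by simp_all
  consider "k = 0" | "k = 1" | "k = 2" using assms(5) by linarith
  then show ?thesis
    using tri_edges_0[OF assms(1-3)] tri_edges_1[OF assms(1-3)] tri_edges_2[OF assms(1-3)] assms(4)
    by cases (simp_all only: nums simp_thms)
qed

lemma quad_edges:
  assumes "\<And>x y. adj x y = adj y x" "c4 adj q1 q2 q3 q4"
    and "at_least 9 (pairs adj [a, b, c, d] [q1, q2, q3, q4])"
    and "at_least k (edges4 adj a b c d)" "k \<le> 2"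
  shows "\<exists>p q r s t u v w.
    mset [p, q, r, s, t, u, v, w] = mset [q1, q2, q3, q4, a, b, c, d] \<and>
    has_c4 adj p q r s \<and> at_least (Suc k) (edges4 adj t u v w)"
proof -
  have nums: "Suc 0 = 1" "Suc 1 = 2" "Suc 2 = 3" by simp_all
  consider "k = 0" | "k = 1" | "k = 2" using assms(5) by linarith
  then show ?thesis
    using quad_edges_0[OF assms(1-3)] quad_edges_1[OF assms(1-3)] quad_edges_2[OF assms(1-3)] assms(4)
    by cases (simp_all only: nums simp_thms)
qed

section \<open>Partial packings\<close>

lemma sum_of_bool_le:
  "(\<Sum>x\<leftarrow>xs. \<Sum>y\<leftarrow>ys. of_bool (adj x y) :: nat) \<le> length xs * length ys"
proof -
  have "(\<Sum>y\<leftarrow>ys. of_bool (adj x y) :: nat) \<le> length ys" for x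
    by (induction ys) (simp_all add: of_bool_def)
  then show ?thesis by (induction xs) (simp_all add: add_mono)
qed

lemma sum_list_perm:
  fixes g :: "'a \<Rightarrow> nat"
  assumes "mset xs = mset ys"
  shows "(\<Sum>x\<leftarrow>xs. g x) = (\<Sum>x\<leftarrow>ys. g x)"
  using assms by (metis mset_map sum_mset_sum_list)

lemma at_least_pairs:
  "at_least k (pairs adj xs ys) \<longleftrightarrow> k \<le> (\<Sum>x\<leftarrow>xs. \<Sum>y\<leftarrow>ys. of_bool (adj x y))"
proof -
  have "(\<Sum>b\<leftarrow>pairs adj xs ys. of_bool b :: nat) = (\<Sum>x\<leftarrow>xs. \<Sum>y\<leftarrow>ys. of_bool (adj x y))"
    by (induction xs) (simp_all add: pairs_def comp_def)
  then show ?thesis by (simp add: at_least_iff)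
qed

text \<open>\<open>conf V adj i j xs\<close>: the list \<open>xs\<close> enumerates what is left of \<open>V\<close> after the removal of
  \<open>i\<close> triangles and \<open>j\<close> quadrilaterals, all disjoint.\<close>

inductive conf :: "'a set \<Rightarrow> ('a \<Rightarrow> 'a \<Rightarrow> bool) \<Rightarrow> nat \<Rightarrow> nat \<Rightarrow> 'a list \<Rightarrow> bool" for V adj where
  conf_start: "distinct xs \<Longrightarrow> set xs = V \<Longrightarrow> conf V adj 0 0 xs"
| conf_tri: "conf V adj i j ys \<Longrightarrow> tri adj p q t \<Longrightarrow> mset ys = mset (p # q # t # xs) \<Longrightarrow>
    conf V adj (Suc i) j xs"
| conf_c4: "conf V adj i j ys \<Longrightarrow> c4 adj p q t u \<Longrightarrow> mset ys = mset (p # q # t # u # xs) \<Longrightarrow>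
    conf V adj i (Suc j) xs"

lemma conf_perm:
  assumes "conf V adj i j xs" "mset xs = mset ys"
  shows "conf V adj i j ys"
  using assms(1)
proof cases
  case conf_start
  then show ?thesis
    using assms(2) conf.conf_start mset_eq_imp_distinct_iff mset_eq_setD by metis
next
  case (conf_tri i zs p q t)
  then show ?thesis using assms(2) conf.conf_tri[of V adj i j zs p q t ys] by simp
next
  case (conf_c4 j zs p q t u)
  then show ?thesis using assms(2) conf.conf_c4[of V adj i j zs p q t u ys] by simp
qed

lemma conf_has_c4:
  assumes "conf V adj i j ys" "has_c4 adj p q t u" "mset ys = mset (p # q # t # u # xs)"
  shows "conf V adj i (Suc j) xs"
  using assms(2) unfolding has_c4_def
proof (elim disjE)
  assume "c4 adj p q t u"
  then show ?thesis by (rule conf_c4[OF assms(1)]) (simp add: assms(3))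
next
  assume "c4 adj p t q u"
  then show ?thesis by (rule conf_c4[OF assms(1)]) (simp add: assms(3))
next
  assume "c4 adj p q u t"
  then show ?thesis by (rule conf_c4[OF assms(1)]) (simp add: assms(3))
qed

lemma conf_has_tri:
  assumes "conf V adj i j ys" "has_tri adj p q t u" "mset ys = mset (p # q # t # u # xs)"
  shows "\<exists>v. conf V adj (Suc i) j (v # xs)"
  using assms(2) unfolding has_tri_def
proof (elim disjE)
  assume "tri adj p q t"
  then have "conf V adj (Suc i) j (u # xs)"
    by (rule conf_tri[OF assms(1)]) (simp add: assms(3))
  then show ?thesis ..
next
  assume "tri adj p q u"
  then have "conf V adj (Suc i) j (t # xs)"
    by (rule conf_tri[OF assms(1)]) (simp add: assms(3))
  then show ?thesis ..
next
  assume "tri adj p t u"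
  then have "conf V adj (Suc i) j (q # xs)"
    by (rule conf_tri[OF assms(1)]) (simp add: assms(3))
  then show ?thesis ..
next
  assume "tri adj q t u"
  then have "conf V adj (Suc i) j (p # xs)"
    by (rule conf_tri[OF assms(1)]) (simp add: assms(3))
  then show ?thesis ..
qed

lemma conf_distinct: "conf V adj i j xs \<Longrightarrow> distinct xs"
proof (induction rule: conf.induct)
  case (conf_tri i j ys p q t xs)
  then show ?case using mset_eq_imp_distinct_iff[OF conf_tri(3)] by simp
next
  case (conf_c4 i j ys p q t u xs)
  then show ?case using mset_eq_imp_distinct_iff[OF conf_c4(3)] by simp
qed

lemma conf_subset: "conf V adj i j xs \<Longrightarrow> set xs \<subseteq> V"
proof (induction rule: conf.induct)
  case (conf_tri i j ys p q t xs)
  then show ?case using mset_eq_setD[OF conf_tri(3)] by auto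
next
  case (conf_c4 i j ys p q t u xs)
  then show ?case using mset_eq_setD[OF conf_c4(3)] by auto
qed simp

lemma conf_length: "conf V adj i j xs \<Longrightarrow> card V = 3 * i + 4 * j + length xs"
proof (induction rule: conf.induct)
  case (conf_start xs)
  then show ?case by (auto simp: distinct_card)
next
  case (conf_tri i j ys p q t xs)
  then show ?case using mset_eq_length[OF conf_tri(3)] by simp
next
  case (conf_c4 i j ys p q t u xs)
  then show ?case using mset_eq_length[OF conf_c4(3)] by simp
qed

text \<open>The members and \<open>xs\<close> partition \<open>V\<close>, so the total weight cannot
  exceed \<open>a\<close> per triangle, \<open>b\<close> per quadrilateral and the weight of
  \<open>xs\<close> unless some member is too heavy. That member is returned to the list; the
  members removed after it stay removed.\<close>

lemma conf_pigeonhole: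
  fixes g :: "'a \<Rightarrow> nat"
  assumes "conf V adj i j xs" "a * i + b * j + (\<Sum>x\<leftarrow>xs. g x) < sum g V"
  shows "(\<exists>i' p q t. i = Suc i' \<and> conf V adj i' j (p # q # t # xs) \<and> tri adj p q t \<and>
            a < g p + g q + g t) \<or>
         (\<exists>j' p q t u. j = Suc j' \<and> conf V adj i j' (p # q # t # u # xs) \<and> c4 adj p q t u \<and>
            b < g p + g q + g t + g u)"
  using assms
proof (induction rule: conf.induct)
  case (conf_start xs)
  then show ?case by (auto simp: sum_list_distinct_conv_sum_set)
next
  case (conf_tri i j ys p q t xs)
  show ?case
  proof (cases "a < g p + g q + g t")
    case True
    then show ?thesis using conf_perm[OF conf_tri(1,3)] conf_tri(2) by blast
  next
    case False
    have "(\<Sum>x\<leftarrow>ys. g x) = g p + g q + g t + (\<Sum>x\<leftarrow>xs. g x)"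
      using sum_list_perm[OF conf_tri(3), of g] by simp
    then have "a * i + b * j + (\<Sum>x\<leftarrow>ys. g x) < sum g V"
      using conf_tri.prems False by simp
    from conf_tri.IH[OF this] show ?thesis
    proof (elim disjE exE conjE)
      fix i' p' q' t'
      assume *: "i = Suc i'" "conf V adj i' j (p' # q' # t' # ys)" "tri adj p' q' t'"
        "a < g p' + g q' + g t'"
      have "conf V adj (Suc i') j (p' # q' # t' # xs)"
        by (rule conf.conf_tri[OF *(2) conf_tri(2)]) (simp add: conf_tri(3))
      then show ?thesis using * by blast
    next
      fix j' p' q' t' u'
      assume *: "j = Suc j'" "conf V adj i j' (p' # q' # t' # u' # ys)" "c4 adj p' q' t' u'"
        "b < g p' + g q' + g t' + g u'"
      have "conf V adj (Suc i) j' (p' # q' # t' # u' # xs)"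
        by (rule conf.conf_tri[OF *(2) conf_tri(2)]) (simp add: conf_tri(3))
      then show ?thesis using * by blast
    qed
  qed
next
  case (conf_c4 i j ys p q t u xs)
  show ?case
  proof (cases "b < g p + g q + g t + g u")
    case True
    then show ?thesis using conf_perm[OF conf_c4(1,3)] conf_c4(2) by blast
  next
    case False
    have "(\<Sum>x\<leftarrow>ys. g x) = g p + g q + g t + g u + (\<Sum>x\<leftarrow>xs. g x)"
      using sum_list_perm[OF conf_c4(3), of g] by simp
    then have "a * i + b * j + (\<Sum>x\<leftarrow>ys. g x) < sum g V"
      using conf_c4.prems False by simp
    from conf_c4.IH[OF this] show ?thesis
    proof (elim disjE exE conjE)
      fix i' p' q' t'
      assume *: "i = Suc i'" "conf V adj i' j (p' # q' # t' # ys)" "tri adj p' q' t'"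
        "a < g p' + g q' + g t'"
      have "conf V adj i' (Suc j) (p' # q' # t' # xs)"
        by (rule conf.conf_c4[OF *(2) conf_c4(2)]) (simp add: conf_c4(3))
      then show ?thesis using * by blast
    next
      fix j' p' q' t' u'
      assume *: "j = Suc j'" "conf V adj i j' (p' # q' # t' # u' # ys)" "c4 adj p' q' t' u'"
        "b < g p' + g q' + g t' + g u'"
      have "conf V adj i (Suc j') (p' # q' # t' # u' # xs)"
        by (rule conf.conf_c4[OF *(2) conf_c4(2)]) (simp add: conf_c4(3))
      then show ?thesis using * by blast
    qed
  qed
qed

text \<open>The order of removal is immaterial, so a triangle can be put back even if quadrilaterals
  were removed after it.\<close>

lemma conf_take_tri:
  assumes "conf V adj i j xs" "i = Suc i'"
  obtains p q t where "conf V adj i' j (p # q # t # xs)" "tri adj p q t"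
  using assms
proof (induction arbitrary: i' thesis rule: conf.induct)
  case (conf_tri i j ys p q t xs)
  then show ?case using conf_perm[OF conf_tri(1,3)] by blast
next
  case (conf_c4 i j ys p q t u xs)
  obtain p' q' t' where *: "conf V adj i' j (p' # q' # t' # ys)" "tri adj p' q' t'"
    using conf_c4 by blast
  have "conf V adj i' (Suc j) (p' # q' # t' # xs)"
    by (rule conf.conf_c4[OF *(1) conf_c4(2)]) (simp add: conf_c4(3))
  then show ?case using * conf_c4.prems by blast
qed simp

lemma conf_take_c4:
  assumes "conf V adj i j xs" "j = Suc j'"
  obtains p q t u where "conf V adj i j' (p # q # t # u # xs)" "c4 adj p q t u"
  using assms
proof (induction arbitrary: j' thesis rule: conf.induct)
  case (conf_tri i j ys p q t xs)
  obtain p' q' t' u' where *: "conf V adj i j' (p' # q' # t' # u' # ys)" "c4 adj p' q' t' u'"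
    using conf_tri by blast
  have "conf V adj (Suc i) j' (p' # q' # t' # u' # xs)"
    by (rule conf.conf_tri[OF *(1) conf_tri(2)]) (simp add: conf_tri(3))
  then show ?case using * conf_tri.prems by blast
next
  case (conf_c4 i j ys p q t u xs)
  then show ?case using conf_perm[OF conf_c4(1,3)] by blast
qed simp

section \<open>The Ore condition\<close>

text \<open>A sum instead of a cardinality, so that degree sums can be counted by the other ends of
  the edges.\<close>

definition deg :: "'a set \<Rightarrow> ('a \<Rightarrow> 'a \<Rightarrow> bool) \<Rightarrow> 'a \<Rightarrow> nat" where
  "deg V adj x = (\<Sum>v\<in>V. of_bool (adj x v))"

text \<open>Here \<open>r\<close> and \<open>s\<close> are one less than in the theorem, so that the degree bound
  \<open>n + r\<close> of the theorem reads \<open>4 * (r + 1) + 4 * (s + 1)\<close>.\<close>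

locale ore_graph =
  fixes V :: "'a set" and adj :: "'a \<Rightarrow> 'a \<Rightarrow> bool" and r s :: nat
  assumes sym: "adj x y = adj y x"
    and irrefl: "\<not> adj x x"
    and ore: "x \<in> V \<Longrightarrow> y \<in> V \<Longrightarrow> x \<noteq> y \<Longrightarrow> \<not> adj x y \<Longrightarrow>
      4 * r + 4 * s + 8 \<le> deg V adj x + deg V adj y"
begin

abbreviation cf :: "nat \<Rightarrow> nat \<Rightarrow> 'a list \<Rightarrow> bool" where
  "cf \<equiv> conf V adj"

abbreviation dg :: "'a \<Rightarrow> nat" where
  "dg \<equiv> deg V adj"

text \<open>Double counting: with each vertex weighted by the number of entries of \<open>ds\<close>
  adjacent to it, the total weight is the degree sum of \<open>ds\<close>, and some member receives
  more than its share. Repetitions in \<open>ds\<close> act as weights.\<close>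

lemma exchange:
  assumes "cf i j xs"
    and "a * i + b * j + (\<Sum>x\<leftarrow>ds. \<Sum>y\<leftarrow>xs. of_bool (adj x y)) < (\<Sum>x\<leftarrow>ds. dg x)"
  obtains (T) i' p q t where "i = Suc i'" "cf i' j (p # q # t # xs)" "tri adj p q t"
      "at_least (Suc a) (pairs adj ds [p, q, t])"
    | (Q) j' p q t u where "j = Suc j'" "cf i j' (p # q # t # u # xs)" "c4 adj p q t u"
      "at_least (Suc b) (pairs adj ds [p, q, t, u])"
proof -
  let ?g = "\<lambda>v. \<Sum>x\<leftarrow>ds. of_bool (adj x v) :: nat"
  have swap: "(\<Sum>y\<leftarrow>ys. ?g y) = (\<Sum>x\<leftarrow>ds. \<Sum>y\<leftarrow>ys. of_bool (adj x y))" for ys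
    by (induction ds) (simp_all add: sum_list_addf)
  have "sum ?g V = (\<Sum>x\<leftarrow>ds. dg x)"
    by (induction ds) (simp_all add: sum.distrib deg_def)
  then have "a * i + b * j + (\<Sum>x\<leftarrow>xs. ?g x) < sum ?g V"
    using assms(2) by (simp add: swap)
  from conf_pigeonhole[OF assms(1) this] show ?thesis
  proof (elim disjE exE conjE)
    fix i' p q t
    assume "i = Suc i'" "cf i' j (p # q # t # xs)" "tri adj p q t" "a < ?g p + ?g q + ?g t"
    moreover from this have "Suc a \<le> (\<Sum>x\<leftarrow>ds. \<Sum>y\<leftarrow>[p, q, t]. of_bool (adj x y))"
      unfolding swap[symmetric] by simp
    ultimately show ?thesis by (intro T) (simp_all only: at_least_pairs)
  next
    fix j' p q t u
    assume "j = Suc j'" "cf i j' (p # q # t # u # xs)" "c4 adj p q t u"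
      "b < ?g p + ?g q + ?g t + ?g u"
    moreover from this have "Suc b \<le> (\<Sum>x\<leftarrow>ds. \<Sum>y\<leftarrow>[p, q, t, u]. of_bool (adj x y))"
      unfolding swap[symmetric] by simp
    ultimately show ?thesis by (intro Q) (simp_all only: at_least_pairs)
  qed
qed

lemma ore_conf:
  assumes "cf i j xs" "x \<in> set xs" "y \<in> set xs" "x \<noteq> y" "\<not> adj x y"
  shows "4 * r + 4 * s + 8 \<le> dg x + dg y"
  using assms ore conf_subset by blast

section \<open>Making the four leftover vertices dense\<close>

lemma four_vertices:
  assumes "cf (Suc r) s [a, b, c, d]" "\<not> at_least 4 (edges4 adj a b c d)"
    and "8 * r + 8 * s + 16 \<le> dg a + dg b + dg c + dg d"
  obtains (T) p q t where "cf r s [p, q, t, a, b, c, d]" "tri adj p q t"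
      "at_least 9 (pairs adj [a, b, c, d] [p, q, t])"
    | (Q) s' p q t u where "s = Suc s'" "cf (Suc r) s' [p, q, t, u, a, b, c, d]" "c4 adj p q t u"
      "at_least 9 (pairs adj [a, b, c, d] [p, q, t, u])"
proof -
  let ?xs = "[a, b, c, d]"
  \<comment> \<open>At most three edges, each counted from both ends. With eight per member this
    makes 8r + 8s + 14, two less than the degree sum.\<close>
  have "(\<Sum>x\<leftarrow>?xs. \<Sum>y\<leftarrow>?xs. of_bool (adj x y)) \<le> (6 :: nat)"
    using assms(2) sym[of b a] sym[of c a] sym[of d a] sym[of c b] sym[of d b] sym[of d c]
    by (simp add: at_least_iff edges4_def irrefl del: at_least.simps)
  then have "8 * Suc r + 8 * s + (\<Sum>x\<leftarrow>?xs. \<Sum>y\<leftarrow>?xs. of_bool (adj x y)) < (\<Sum>x\<leftarrow>?xs. dg x)"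
    using assms(3) by simp
  from assms(1) this show ?thesis
    by (rule exchange) (use T Q in auto)
qed

lemma add_edge:
  assumes conf: "cf (Suc r) s [a, b, c, d]" and edges: "at_least k (edges4 adj a b c d)" and "k \<le> 2"
  shows "\<exists>a b c d. cf (Suc r) s [a, b, c, d] \<and> at_least (Suc k) (edges4 adj a b c d)"
proof (cases "at_least (Suc k) (edges4 adj a b c d)")
  case True
  then show ?thesis using conf by blast
next
  case False
  have dist: "distinct [a, b, c, d]" using conf conf_distinct by blast
  have few: "(\<Sum>b\<leftarrow>edges4 adj a b c d. of_bool b) \<le> (2 :: nat)"
    using False \<open>k \<le> 2\<close> by (simp add: at_least_iff del: at_least.simps)
  \<comment> \<open>The six pairs form three perfect matchings, and two edges leave one of them
    free: two disjoint nonadjacent pairs.\<close>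
  then have "\<not> adj a b \<and> \<not> adj c d \<or> \<not> adj a c \<and> \<not> adj b d \<or> \<not> adj a d \<and> \<not> adj b c"
    by (auto simp: edges4_def of_bool_def split: if_splits)
  then have degs: "8 * r + 8 * s + 16 \<le> dg a + dg b + dg c + dg d"
    using dist ore_conf[OF conf, of a b] ore_conf[OF conf, of c d] ore_conf[OF conf, of a c]
      ore_conf[OF conf, of b d] ore_conf[OF conf, of a d] ore_conf[OF conf, of b c]
    by auto
  have "\<not> at_least 4 (edges4 adj a b c d)"
    using few by (simp add: at_least_iff del: at_least.simps)
  from conf this degs show ?thesis
  proof (cases rule: four_vertices)
    case (T p q t)
    show ?thesis
      using tri_edges[OF sym T(2,3) edges \<open>k \<le> 2\<close>] conf_tri[OF T(1)] by metis
  next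
    case (Q s' p q t u)
    show ?thesis
      using quad_edges[OF sym Q(3,4) edges \<open>k \<le> 2\<close>] conf_has_c4[OF Q(2)] Q(1) by metis
  qed
qed

text \<open>An edge from \<open>a\<close> to the triangle already gives four. Otherwise pairing each
  of three copies of \<open>a\<close> with one of \<open>b\<close>, \<open>c\<close>,
  \<open>d\<close> gives degree sum 12r + 12s + 24; twelve per member and the six inner adjacencies
  leave a surplus.\<close>

lemma triangle_leftover:
  assumes conf: "cf (Suc r) s [a, b, c, d]" and tri: "tri adj b c d"
  shows "\<exists>a b c d. cf (Suc r) s [a, b, c, d] \<and> at_least 4 (edges4 adj a b c d)"
proof (cases "adj a b \<or> adj a c \<or> adj a d")
  case True
  then have "at_least 4 (edges4 adj a b c d)"
    using tri by (auto simp: edges4_def tri_def)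
  then show ?thesis using conf by blast
next
  case False
  let ?ds = "[a, a, a, b, c, d]"
  have "distinct [a, b, c, d]" using conf conf_distinct by blast
  then have "12 * r + 12 * s + 24 \<le> (\<Sum>x\<leftarrow>?ds. dg x)"
    using False ore_conf[OF conf, of a b] ore_conf[OF conf, of a c] ore_conf[OF conf, of a d]
    by simp
  moreover have "(\<Sum>x\<leftarrow>?ds. \<Sum>y\<leftarrow>[a, b, c, d]. of_bool (adj x y)) \<le> (6 :: nat)"
    using False sym[of b a] sym[of c a] sym[of d a] by (simp add: irrefl)
  ultimately have "12 * Suc r + 12 * s + (\<Sum>x\<leftarrow>?ds. \<Sum>y\<leftarrow>[a, b, c, d]. of_bool (adj x y)) <
      (\<Sum>x\<leftarrow>?ds. dg x)"
    by simp
  with conf show ?thesis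
  proof (cases rule: exchange)
    case (T i p q t)
    \<comment> \<open>The other three vertices send at most nine of the thirteen edges. The two
      triangles can then exchange roles, \<open>p\<close>, \<open>q\<close>, \<open>t\<close>
      becoming the leftover triangle with an edge to \<open>a\<close>.\<close>
    have "adj a p \<or> adj a q \<or> adj a t"
    proof (rule ccontr)
      assume "\<not> ?thesis"
      then show False
        using T(4) sum_of_bool_le[of adj "[p, q, t]" "[b, c, d]"]
        by (simp add: at_least_pairs del: at_least.simps)
    qed
    then have "at_least 4 (edges4 adj p q t a)"
      using T(3) sym[of a p] sym[of a q] sym[of a t] by (auto simp: edges4_def tri_def)
    moreover have "cf (Suc i) s [p, q, t, a]"
      by (rule conf_tri[OF T(2) tri]) simp
    ultimately show ?thesis using T(1) by blast
  next
    case (Q j p q t u)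
    then have "at_least 13 (pairs adj ?ds [p, q, t, u])" by simp
    from quad_triangle[OF sym Q(3) tri this] show ?thesis
      using conf_has_c4[OF Q(2)] Q(1) by metis
  qed
qed

lemma has_tri_leftover:
  assumes conf: "cf (Suc r) s [a, b, c, d]" and "has_tri adj a b c d"
  shows "\<exists>a b c d. cf (Suc r) s [a, b, c, d] \<and> at_least 4 (edges4 adj a b c d)"
  using assms(2) unfolding has_tri_def
proof (elim disjE)
  assume "tri adj a b c"
  with conf_perm[OF conf, of "[d, a, b, c]"] show ?thesis by (auto intro!: triangle_leftover)
next
  assume "tri adj a b d"
  with conf_perm[OF conf, of "[c, a, b, d]"] show ?thesis by (auto intro!: triangle_leftover)
next
  assume "tri adj a c d"
  with conf_perm[OF conf, of "[b, a, c, d]"] show ?thesis by (auto intro!: triangle_leftover)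
next
  assume "tri adj b c d"
  with conf show ?thesis by (rule triangle_leftover)
qed

lemma has_c4_edges: "has_c4 adj a b c d \<Longrightarrow> at_least 4 (edges4 adj a b c d)"
  using sym[of b a] sym[of c a] sym[of d a] sym[of c b] sym[of d b] sym[of d c]
  by (auto simp: has_c4_def c4_def edges4_def)

text \<open>Without a fourth edge, \<open>a c\<close> and \<open>b d\<close> are disjoint
  nonadjacent pairs, and nine edges to one member allow the path to be turned into a quadrilateral
  or a triangle.\<close>

lemma path_leftover:
  assumes conf: "cf (Suc r) s [a, b, c, d]" and path: "adj a b" "adj b c" "adj c d"
  shows "\<exists>a b c d. cf (Suc r) s [a, b, c, d] \<and> at_least 4 (edges4 adj a b c d)"
proof (cases "at_least 4 (edges4 adj a b c d)")
  case True
  then show ?thesis using conf by blast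
next
  case False
  then have "\<not> adj a c" "\<not> adj b d"
    using path by (auto simp: edges4_def)
  moreover have "distinct [a, b, c, d]" using conf conf_distinct by blast
  ultimately have "8 * r + 8 * s + 16 \<le> dg a + dg b + dg c + dg d"
    using ore_conf[OF conf, of a c] ore_conf[OF conf, of b d] by simp
  with conf False show ?thesis
  proof (cases rule: four_vertices)
    case (T p q t)
    then obtain p' q' t' a' b' c' d' where
      "mset [p, q, t, a, b, c, d] = mset [p', q', t', a', b', c', d']" "tri adj p' q' t'"
      and *: "has_c4 adj a' b' c' d' \<or> has_tri adj a' b' c' d'"
      using tri_path4[OF sym T(2) path T(3)] by metis
    then have "cf (Suc r) s [a', b', c', d']"
      using conf_tri[OF T(1)] by blast
    then show ?thesis using * has_c4_edges has_tri_leftover by blast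
  next
    case (Q s' p q t u)
    then obtain p' q' t' u' a' b' c' d' where
      "mset [p, q, t, u, a, b, c, d] = mset [p', q', t', u', a', b', c', d']" "has_c4 adj p' q' t' u'"
      and *: "has_c4 adj a' b' c' d' \<or> has_tri adj a' b' c' d'"
      using quad_path4[OF sym Q(3) path Q(4)] by metis
    then have "cf (Suc r) s [a', b', c', d']"
      using conf_has_c4[OF Q(2)] Q(1) by blast
    then show ?thesis using * has_c4_edges has_tri_leftover by blast
  qed
qed

lemma has_p4_path:
  assumes "has_p4 adj a b c d"
  shows "\<exists>p q t u. mset [a, b, c, d] = mset [p, q, t, u] \<and> adj p q \<and> adj q t \<and> adj t u"
proof (rule ccontr)
  assume "\<not> ?thesis"
  then have H: "\<not> (adj p q \<and> adj q t \<and> adj t u)" if "mset [a, b, c, d] = mset [p, q, t, u]" for p q t u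
    using that by blast
  note [simp] = sym has_p4_def
  \<comment> \<open>The twelve orders of four vertices up to reversal.\<close>
  from assms[simplified]
    H[of a b c d, simplified] H[of a b d c, simplified] H[of b a c d, simplified]
    H[of b a d c, simplified] H[of a c b d, simplified] H[of a c d b, simplified]
    H[of c a b d, simplified] H[of c a d b, simplified] H[of a d b c, simplified]
    H[of a d c b, simplified] H[of d a b c, simplified] H[of d a c b, simplified]
  show False by sat
qed

lemma has_p4_leftover:
  assumes "cf (Suc r) s [a, b, c, d]" and "has_p4 adj a b c d \<or> has_tri adj a b c d"
  shows "\<exists>a b c d. cf (Suc r) s [a, b, c, d] \<and> at_least 4 (edges4 adj a b c d)"
  using assms has_tri_leftover has_p4_path path_leftover conf_perm by metis

text \<open>Only the leaves are counted. Without a fourth edge they are pairwise nonadjacent, and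
  half the sum of the three degree conditions is 6r + 6s + 12, more than six per member plus the
  three edges to the centre.\<close>

lemma star_leftover:
  assumes conf: "cf (Suc r) s [a, b, c, d]" and star: "adj a b" "adj a c" "adj a d"
  shows "\<exists>a b c d. cf (Suc r) s [a, b, c, d] \<and> at_least 4 (edges4 adj a b c d)"
proof (cases "at_least 4 (edges4 adj a b c d)")
  case True
  then show ?thesis using conf by blast
next
  case False
  then have non: "\<not> adj b c" "\<not> adj b d" "\<not> adj c d"
    using star by (auto simp: edges4_def)
  let ?ds = "[b, c, d]"
  have "distinct [a, b, c, d]" using conf conf_distinct by blast
  then have "6 * r + 6 * s + 12 \<le> (\<Sum>x\<leftarrow>?ds. dg x)"
    using non ore_conf[OF conf, of b c] ore_conf[OF conf, of b d] ore_conf[OF conf, of c d]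
    by simp
  moreover have "(\<Sum>x\<leftarrow>?ds. \<Sum>y\<leftarrow>[a, b, c, d]. of_bool (adj x y)) \<le> (3 :: nat)"
    using non sym[of c b] sym[of d b] sym[of d c] by (simp add: irrefl)
  ultimately have "6 * Suc r + 6 * s + (\<Sum>x\<leftarrow>?ds. \<Sum>y\<leftarrow>[a, b, c, d]. of_bool (adj x y)) <
      (\<Sum>x\<leftarrow>?ds. dg x)"
    by simp
  with conf show ?thesis
  proof (cases rule: exchange)
    case (T i p q t)
    then have "at_least 7 (pairs adj ?ds [p, q, t])" by simp
    from tri_star[OF sym T(3) star this] show ?thesis
      using conf_tri[OF T(2)] T(1) has_p4_leftover by metis
  next
    case (Q j p q t u)
    then have "at_least 7 (pairs adj ?ds [p, q, t, u])" by simp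
    from quad_star[OF sym Q(3) star this] show ?thesis
      using conf_has_c4[OF Q(2)] Q(1) has_p4_leftover by metis
  qed
qed

text \<open>Three edges on four vertices contain a path, a triangle or a star; the star can have any
  of the four vertices as its centre.\<close>

lemma three_edges_leftover:
  assumes conf: "cf (Suc r) s [a, b, c, d]" and "at_least 3 (edges4 adj a b c d)"
  shows "\<exists>a b c d. cf (Suc r) s [a, b, c, d] \<and> at_least 4 (edges4 adj a b c d)"
proof -
  note [simp] = shape_defs sym
  from assms(2)[simplified] have "has_p4 adj a b c d \<or> has_tri adj a b c d \<or>
    adj a b \<and> adj a c \<and> adj a d \<or> adj b a \<and> adj b c \<and> adj b d \<or>
    adj c a \<and> adj c b \<and> adj c d \<or> adj d a \<and> adj d b \<and> adj d c"
    by simp sat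
  then show ?thesis
    using has_p4_leftover[OF conf] star_leftover[OF conf]
      star_leftover[OF conf_perm[OF conf, of "[b, a, c, d]"]]
      star_leftover[OF conf_perm[OF conf, of "[c, a, b, d]"]]
      star_leftover[OF conf_perm[OF conf, of "[d, a, b, c]"]]
    by (elim disjE conjE) (simp_all only: mset.simps add_mset_commute simp_thms)
qed

lemma leftover_dense:
  assumes "cf (Suc r) s [a, b, c, d]"
  shows "\<exists>a b c d. cf (Suc r) s [a, b, c, d] \<and> at_least 4 (edges4 adj a b c d)"
proof -
  have "at_least 0 (edges4 adj a b c d)" by (simp add: edges4_def)
  with assms obtain a b c d where "cf (Suc r) s [a, b, c, d]" "at_least (Suc 0) (edges4 adj a b c d)"
    using add_edge by blast
  then obtain a b c d where
    "cf (Suc r) s [a, b, c, d]" "at_least (Suc (Suc 0)) (edges4 adj a b c d)"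
    using add_edge[of a b c d "Suc 0"] by auto
  then obtain a b c d where
    "cf (Suc r) s [a, b, c, d]" "at_least (Suc (Suc (Suc 0))) (edges4 adj a b c d)"
    using add_edge[of a b c d "Suc (Suc 0)"] by auto
  then show ?thesis using three_edges_leftover by (simp only: numeral_3_eq_3)
qed

section \<open>Restoring the numbers of triangles and quadrilaterals\<close>

text \<open>If no further triangle can be gained, a quadrilateral \<open>Q\<close> of the packing is induced and the
  vertices outside the packing send few edges to it, so the two nonadjacent pairs of \<open>Q\<close> force nine
  edges from \<open>Q\<close> to another member.\<close>

lemma missing_triangle:
  assumes "cf r (Suc s) [x, y, z]"
  shows "\<exists>xs. cf (Suc r) s xs"
proof (rule ccontr)
  assume no: "\<not> ?thesis"
  \<comment> \<open>There is one quadrilateral more than required, so one can be dissolved.\<close>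
  obtain q1 q2 q3 q4 where conf: "cf r s [q1, q2, q3, q4, x, y, z]" and Q: "c4 adj q1 q2 q3 q4"
    using conf_take_c4[OF assms] by blast
  note edges = Q[unfolded c4_def]
  have notri: "\<not> tri adj p q t" if "mset [q1, q2, q3, q4, x, y, z] = mset (p # q # t # ws)" for p q t ws
    using conf_tri[OF conf _ that] no by blast
  have non: "\<not> adj q1 q3" "\<not> adj q2 q4"
    using notri[of q1 q2 q3 "[q4, x, y, z]"] notri[of q2 q3 q4 "[q1, x, y, z]"] edges
    by (auto simp: tri_def)
  have few: "of_bool (adj q1 w) + of_bool (adj q2 w) + of_bool (adj q3 w) + of_bool (adj q4 w) \<le> (2 :: nat)"
    if "mset [x, y, z] = mset [w, w1, w2]" for w w1 w2
  proof -
    \<comment> \<open>An outside vertex adjacent to both ends of a side would give the missing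
      triangle, so it has at most one neighbour on each of two opposite sides.\<close>
    have "\<not> (adj q1 w \<and> adj q2 w)" "\<not> (adj q3 w \<and> adj q4 w)"
      using notri[of q1 q2 w "[q3, q4, w1, w2]"] notri[of q3 q4 w "[q1, q2, w1, w2]"] edges that
      by (auto simp: tri_def)
    then show ?thesis by (auto simp: of_bool_def)
  qed
  let ?ds = "[q1, q2, q3, q4]"
  have "distinct ?ds" using conf_distinct[OF conf] by simp
  then have "8 * r + 8 * s + 16 \<le> (\<Sum>x\<leftarrow>?ds. dg x)"
    using non ore_conf[OF conf, of q1 q3] ore_conf[OF conf, of q2 q4] by simp
  \<comment> \<open>Each of the seven vertices outside the packing is adjacent to at most two of the
    \<open>qi\<close>.\<close>
  moreover have "(\<Sum>v\<leftarrow>?ds. \<Sum>w\<leftarrow>[q1, q2, q3, q4, x, y, z]. of_bool (adj v w)) \<le> (14 :: nat)"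
  proof -
    let ?e = "\<lambda>w. of_bool (adj q1 w) + of_bool (adj q2 w) + of_bool (adj q3 w) + of_bool (adj q4 w) :: nat"
    have "?e q1 \<le> 2" "?e q2 \<le> 2" "?e q3 \<le> 2" "?e q4 \<le> 2"
      using non sym[of q3 q1] sym[of q4 q2] by (simp_all add: irrefl)
    moreover have "?e x \<le> 2" "?e y \<le> 2" "?e z \<le> 2"
      by (rule few[of x y z] few[of y x z] few[of z x y], simp)+
    moreover have "(\<Sum>v\<leftarrow>?ds. \<Sum>w\<leftarrow>[q1, q2, q3, q4, x, y, z]. of_bool (adj v w)) =
        ?e q1 + ?e q2 + ?e q3 + ?e q4 + ?e x + ?e y + ?e z"
      by (simp only: list.map sum_list.Cons sum_list.Nil)
    ultimately show ?thesis by linarith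
  qed
  ultimately have "8 * r + 8 * s + (\<Sum>v\<leftarrow>?ds. \<Sum>w\<leftarrow>[q1, q2, q3, q4, x, y, z]. of_bool (adj v w)) <
      (\<Sum>x\<leftarrow>?ds. dg x)"
    by simp
  with conf show False
  proof (cases rule: exchange)
    case (T i p q t)
    then have "at_least 9 (pairs adj ?ds [p, q, t])" by simp
    from tri_quad[OF sym T(3) Q this] obtain a b c d e f g where
      *: "mset [a, b, c, d, e, f, g] = mset [p, q, t, q1, q2, q3, q4]" "tri adj a b c" "has_tri adj d e f g"
      by blast
    have "mset ([p, q, t, q1, q2, q3, q4] @ [x, y, z]) = mset ([a, b, c, d, e, f, g] @ [x, y, z])"
      unfolding mset_append *(1) ..
    then have "cf (Suc i) s [d, e, f, g, x, y, z]"
      by (intro conf_tri[OF T(2) *(2)]) (simp only: append.simps)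
    from conf_has_tri[OF this *(3), of "[x, y, z]"] show False using no T(1) by auto
  next
    case (Q j p q t u)
    then have "at_least 9 (pairs adj ?ds [p, q, t, u])" by simp
    from quad_quad[OF sym Q(3) \<open>c4 adj q1 q2 q3 q4\<close> this] obtain a b c d e f g h where
      *: "mset [a, b, c, d, e, f, g, h] = mset [p, q, t, u, q1, q2, q3, q4]"
        "has_c4 adj a b c d" "has_tri adj e f g h"
      by blast
    have "mset ([p, q, t, u, q1, q2, q3, q4] @ [x, y, z]) =
        mset ([a, b, c, d, e, f, g, h] @ [x, y, z])"
      unfolding mset_append *(1) ..
    then have "cf r (Suc j) [e, f, g, h, x, y, z]"
      by (intro conf_has_c4[OF Q(2) *(2)]) (simp only: append.simps)
    from conf_has_tri[OF this *(3), of "[x, y, z]"] show False using no Q(1) by auto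
  qed
qed

text \<open>Two neighbours of \<open>v\<close> are the ends of a path through all three vertices of
  the triangle, which \<open>v\<close> closes.\<close>

lemma tri_vertex_has_c4:
  assumes "tri adj t1 t2 t3" "2 \<le> of_bool (adj t1 v) + of_bool (adj t2 v) + (of_bool (adj t3 v) :: nat)"
  shows "has_c4 adj v t1 t2 t3"
proof -
  have "adj t1 v \<and> adj t2 v \<or> adj t2 v \<and> adj t3 v \<or> adj t1 v \<and> adj t3 v"
    using assms(2) by (auto simp: of_bool_def split: if_splits)
  then show ?thesis
    using assms(1) by (auto simp: has_c4_def c4_def tri_def sym)
qed

text \<open>Of two disjoint perfect matchings between the triangles one avoids the only possible
  edge, and its three nonadjacent pairs cover all six vertices.\<close>

lemma tri_tri_degrees:
  assumes conf: "cf i j xs" and "distinct [t1, t2, t3, u1, u2, u3]" "{t1, t2, t3, u1, u2, u3} \<subseteq> set xs"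
    and few: "\<not> at_least 2 (pairs adj [t1, t2, t3] [u1, u2, u3])"
  shows "12 * r + 12 * s + 24 \<le> dg t1 + dg t2 + dg t3 + dg u1 + dg u2 + dg u3"
proof -
  have "\<not> adj t1 u1 \<and> \<not> adj t2 u2 \<and> \<not> adj t3 u3 \<or> \<not> adj t1 u2 \<and> \<not> adj t2 u3 \<and> \<not> adj t3 u1"
    using few by (auto simp: pairs_def)
  then show ?thesis
    using assms(2,3) ore_conf[OF conf, of t1 u1] ore_conf[OF conf, of t2 u2] ore_conf[OF conf, of t3 u3]
      ore_conf[OF conf, of t1 u2] ore_conf[OF conf, of t2 u3] ore_conf[OF conf, of t3 u1]
    by auto
qed

text \<open>Two triangles too many are traded for one quadrilateral: if this is impossible, triangles
  are joined to each other by at most one edge, so nearly all edges at three of the triangles go to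
  the quadrilaterals, and some quadrilateral receives at least 19 of them.\<close>

lemma surplus_triangles:
  assumes s: "s = Suc s'" and "cf (Suc (Suc (Suc r))) s' [x, y]"
  shows "\<exists>xs. cf (Suc r) s xs"
proof (rule ccontr)
  assume no: "\<not> ?thesis"
  obtain t1 t2 t3 where 1: "cf (Suc (Suc r)) s' [t1, t2, t3, x, y]" and T: "tri adj t1 t2 t3"
    using conf_take_tri[OF assms(2)] by blast
  obtain u1 u2 u3 where 2: "cf (Suc r) s' [u1, u2, u3, t1, t2, t3, x, y]" and U: "tri adj u1 u2 u3"
    using conf_take_tri[OF 1] by blast
  obtain v1 v2 v3 where conf: "cf r s' [v1, v2, v3, u1, u2, u3, t1, t2, t3, x, y]"
    and W: "tri adj v1 v2 v3"
    using conf_take_tri[OF 2] by blast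
  let ?xs = "[v1, v2, v3, u1, u2, u3, t1, t2, t3, x, y]"
  \<comment> \<open>Otherwise \<open>v\<close> closes a quadrilateral with one dissolved triangle,
    and another one supplies the triangle still required.\<close>
  have single: "of_bool (adj a v) + of_bool (adj b v) + of_bool (adj c v) \<le> (1 :: nat)"
    if "tri adj a b c" "tri adj a' b' c'" "mset ?xs = mset (v # a # b # c # a' # b' # c' # ws)"
    for a b c a' b' c' v ws
  proof (rule ccontr)
    assume "\<not> ?thesis"
    then have "has_c4 adj v a b c" using tri_vertex_has_c4[OF that(1)] by simp
    from conf_has_c4[OF conf this that(3)] have "cf r s (a' # b' # c' # ws)"
      by (simp add: s)
    from conf_tri[OF this that(2), of ws] show False using no by auto
  qed
  \<comment> \<open>Otherwise two of the dissolved triangles yield a quadrilateral, and the third is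
    kept.\<close>
  have double: "\<not> at_least 2 (pairs adj [a, b, c] [a', b', c'])"
    if "tri adj a b c" "tri adj a' b' c'" "tri adj a'' b'' c''"
      "mset ?xs = mset (a # b # c # a' # b' # c' # a'' # b'' # c'' # ws)"
    for a b c a' b' c' a'' b'' c'' ws
  proof
    assume "at_least 2 (pairs adj [a, b, c] [a', b', c'])"
    from tri_tri[OF sym that(1,2) this] obtain d e f g h k where
      *: "mset [d, e, f, g, h, k] = mset [a, b, c, a', b', c']" "has_c4 adj d e f g"
      by blast
    have "mset ?xs = mset ([d, e, f, g, h, k] @ a'' # b'' # c'' # ws)"
      unfolding mset_append *(1) that(4) by simp
    then have "cf r (Suc s') (h # k # a'' # b'' # c'' # ws)"
      by (intro conf_has_c4[OF conf *(2)]) (simp only: append.simps)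
    from conf_tri[OF this that(3), of "h # k # ws"] show False using no s by auto
  qed
  have dTU: "\<not> at_least 2 (pairs adj [t1, t2, t3] [u1, u2, u3])"
    by (rule double[OF T U W, of "[x, y]"]) simp
  have dTW: "\<not> at_least 2 (pairs adj [t1, t2, t3] [v1, v2, v3])"
    by (rule double[OF T W U, of "[x, y]"]) simp
  have dUW: "\<not> at_least 2 (pairs adj [u1, u2, u3] [v1, v2, v3])"
    by (rule double[OF U W T, of "[x, y]"]) simp
  let ?ds = "[t1, t2, t3, u1, u2, u3, v1, v2, v3]"
  have "distinct ?ds" using conf_distinct[OF conf] by auto
  \<comment> \<open>Adding the bounds for the three pairs of triangles counts every degree
    twice.\<close>
  then have degs: "18 * r + 18 * s' + 54 \<le> (\<Sum>x\<leftarrow>?ds. dg x)"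
    using tri_tri_degrees[OF conf _ _ dTU] tri_tri_degrees[OF conf _ _ dTW]
      tri_tri_degrees[OF conf _ _ dUW]
    by (simp add: s)
  have inner: "(\<Sum>x\<leftarrow>[a, b, c]. \<Sum>y\<leftarrow>[a, b, c]. of_bool (adj x y)) \<le> (6 :: nat)" for a b c
    by (simp add: irrefl)
  have cross: "(\<Sum>x\<leftarrow>[a, b, c]. \<Sum>y\<leftarrow>[a', b', c']. of_bool (adj x y)) \<le> (1 :: nat)"
    "(\<Sum>x\<leftarrow>[a', b', c']. \<Sum>y\<leftarrow>[a, b, c]. of_bool (adj x y)) \<le> (1 :: nat)"
    if "\<not> at_least 2 (pairs adj [a, b, c] [a', b', c'])" for a b c a' b' c'
    using that by (simp_all add: at_least_pairs sym del: at_least.simps)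
  \<comment> \<open>Six adjacencies inside each triangle, at most one for each of the six ordered
    pairs of triangles, and at most three at each of \<open>x\<close> and \<open>y\<close>.\<close>
  have "(\<Sum>x\<leftarrow>?ds. \<Sum>y\<leftarrow>?xs. of_bool (adj x y)) \<le> (30 :: nat)"
  proof -
    have x: "of_bool (adj t1 x) + of_bool (adj t2 x) + of_bool (adj t3 x) \<le> (1 :: nat)"
      "of_bool (adj u1 x) + of_bool (adj u2 x) + of_bool (adj u3 x) \<le> (1 :: nat)"
      "of_bool (adj v1 x) + of_bool (adj v2 x) + of_bool (adj v3 x) \<le> (1 :: nat)"
      using single[OF T U, of x "[v1, v2, v3, y]"] single[OF U T, of x "[v1, v2, v3, y]"]
        single[OF W T, of x "[u1, u2, u3, y]"] by simp_all
    have y: "of_bool (adj t1 y) + of_bool (adj t2 y) + of_bool (adj t3 y) \<le> (1 :: nat)"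
      "of_bool (adj u1 y) + of_bool (adj u2 y) + of_bool (adj u3 y) \<le> (1 :: nat)"
      "of_bool (adj v1 y) + of_bool (adj v2 y) + of_bool (adj v3 y) \<le> (1 :: nat)"
      using single[OF T U, of y "[v1, v2, v3, x]"] single[OF U T, of y "[v1, v2, v3, x]"]
        single[OF W T, of y "[u1, u2, u3, x]"] by simp_all
    show ?thesis
      using inner[of t1 t2 t3] inner[of u1 u2 u3] inner[of v1 v2 v3]
        cross[OF dTU] cross[OF dTW] cross[OF dUW] x y
      by (simp only: list.map sum_list.Cons sum_list.Nil)
  qed
  \<comment> \<open>The share of a triangle is three, as each of the three dissolved triangles can
    send it at most one edge; the share of a quadrilateral is eighteen.\<close>
  with degs have "3 * r + 18 * s' + (\<Sum>x\<leftarrow>?ds. \<Sum>y\<leftarrow>?xs. of_bool (adj x y)) < (\<Sum>x\<leftarrow>?ds. dg x)"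
    by simp
  with conf show False
  proof (cases rule: exchange)
    case (T i p q t)
    note P = T(3)
    have far: "\<not> at_least 2 (pairs adj [a, b, c] [p, q, t])"
      if "tri adj a b c" "tri adj a' b' c'" "tri adj a'' b'' c''"
        "mset ?xs = mset (a # b # c # a' # b' # c' # a'' # b'' # c'' # ws)"
      for a b c a' b' c' a'' b'' c'' ws
    proof
      assume "at_least 2 (pairs adj [a, b, c] [p, q, t])"
      from tri_tri[OF sym that(1) P this] obtain d e f g h k where
        *: "mset [d, e, f, g, h, k] = mset [a, b, c, p, q, t]" "has_c4 adj d e f g"
        by blast
      have "mset ([p, q, t] @ ?xs) = mset ([d, e, f, g, h, k] @ a' # b' # c' # a'' # b'' # c'' # ws)"
        unfolding mset_append *(1) that(4) by simp
      then have "cf i (Suc s') (h # k # a' # b' # c' # a'' # b'' # c'' # ws)"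
        by (intro conf_has_c4[OF T(2) *(2)]) (simp only: append.simps)
      from conf_tri[OF this that(2), of "h # k # a'' # b'' # c'' # ws"]
      have "cf (Suc i) (Suc s') (h # k # a'' # b'' # c'' # ws)" by simp
      from conf_tri[OF this that(3), of "h # k # ws"] show False using no s T(1) by auto
    qed
    have "\<not> at_least 2 (pairs adj [t1, t2, t3] [p, q, t])"
      by (rule far[OF \<open>tri adj t1 t2 t3\<close> U W, of "[x, y]"]) simp
    moreover have "\<not> at_least 2 (pairs adj [u1, u2, u3] [p, q, t])"
      by (rule far[OF U \<open>tri adj t1 t2 t3\<close> W, of "[x, y]"]) simp
    moreover have "\<not> at_least 2 (pairs adj [v1, v2, v3] [p, q, t])"
      by (rule far[OF W \<open>tri adj t1 t2 t3\<close> U, of "[x, y]"]) simp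
    ultimately show False using T(4)
      by (simp add: at_least_pairs del: at_least.simps)
  next
    case (Q j q1 q2 q3 q4)
    let ?f = "\<lambda>a b c. \<Sum>x\<leftarrow>[a, b, c]. \<Sum>y\<leftarrow>[q1, q2, q3, q4]. of_bool (adj x y) :: nat"
    have bound: "\<not> (7 \<le> ?f a b c \<and> 5 \<le> ?f a' b' c') \<and> \<not> (11 \<le> ?f a b c \<and> 3 \<le> ?f a' b' c')"
      if "tri adj a b c" "tri adj a' b' c'" "tri adj a'' b'' c''"
        "mset ?xs = mset (a # b # c # a' # b' # c' # a'' # b'' # c'' # ws)"
      for a b c a' b' c' a'' b'' c'' ws
    proof (rule ccontr)
      assume "\<not> ?thesis"
      then have "at_least 7 (pairs adj [a, b, c] [q1, q2, q3, q4]) \<and>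
          at_least 5 (pairs adj [a', b', c'] [q1, q2, q3, q4]) \<or>
          at_least 11 (pairs adj [a, b, c] [q1, q2, q3, q4]) \<and>
          at_least 3 (pairs adj [a', b', c'] [q1, q2, q3, q4])"
        unfolding at_least_pairs by blast
      then have "\<exists>d e f g h k l m n o'.
          mset [d, e, f, g, h, k, l, m, n, o'] = mset [a, b, c, a', b', c', q1, q2, q3, q4] \<and>
          has_c4 adj d e f g \<and> has_c4 adj h k l m"
        using tri_tri_quad_7_5[OF sym that(1,2) Q(3)] tri_tri_quad_11_3[OF sym that(1,2) Q(3)] by blast
      then obtain d e f g h k l m n o' where
        *: "mset [d, e, f, g, h, k, l, m, n, o'] = mset [a, b, c, a', b', c', q1, q2, q3, q4]"
          "has_c4 adj d e f g" "has_c4 adj h k l m"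
        by blast
      have "mset ([q1, q2, q3, q4] @ ?xs) =
          mset ([d, e, f, g, h, k, l, m, n, o'] @ a'' # b'' # c'' # ws)"
        unfolding mset_append *(1) that(4) by simp
      then have "cf r (Suc j) (h # k # l # m # n # o' # a'' # b'' # c'' # ws)"
        by (intro conf_has_c4[OF Q(2) *(2)]) (simp only: append.simps)
      from conf_has_c4[OF this *(3), of "n # o' # a'' # b'' # c'' # ws"]
      have "cf r (Suc (Suc j)) (n # o' # a'' # b'' # c'' # ws)" by simp
      from conf_tri[OF this that(3), of "n # o' # ws"] show False using no s Q(1) by auto
    qed
    have max: "?f a b c \<le> 12" for a b c
      using sum_of_bool_le[of adj "[q1, q2, q3, q4]" "[a, b, c]"] by simp
    \<comment> \<open>Some triangle sends at least seven of these edges, so the others send at most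
      four each; a total of 19 then requires eleven from the first, which limits the others to two
      each.\<close>
    have "19 \<le> ?f t1 t2 t3 + ?f u1 u2 u3 + ?f v1 v2 v3"
      using Q(4) by (simp add: at_least_pairs del: at_least.simps)
    then show False
      using bound[OF T U W, of "[x, y]"] bound[OF U T W, of "[x, y]"] bound[OF T W U, of "[x, y]"]
        bound[OF W T U, of "[x, y]"] bound[OF U W T, of "[x, y]"] bound[OF W U T, of "[x, y]"]
        max[of t1 t2 t3] max[of u1 u2 u3] max[of v1 v2 v3]
      by (simp only: mset.simps add_mset_commute simp_thms) presburger
  qed
qed

lemma dense_has_c4_or_tri:
  assumes "at_least 4 (edges4 adj a b c d)"
  shows "has_c4 adj a b c d \<or> has_tri adj a b c d"
proof -
  note [simp] = shape_defs sym
  from assms[simplified] show ?thesis by simp sat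
qed

text \<open>The path is what remains of a damaged quadrilateral. The dense set replaces it or gives
  a surplus triangle. In the latter case the path is improved to a quadrilateral, for which one
  triangle is given up, or to a second surplus triangle, and two surplus triangles can be
  traded.\<close>

lemma missing_quad:
  assumes s: "s = Suc s'" and conf: "cf (Suc r) s' [x, p, q, y, d1, d2, d3, d4]"
    and path: "adj x p" "adj p q" "adj q y" and "\<not> adj x y"
    and dense: "at_least 4 (edges4 adj d1 d2 d3 d4)"
  shows "\<exists>xs. cf (Suc r) s xs"
proof (rule ccontr)
  assume no: "\<not> ?thesis"
  have "\<not> has_c4 adj d1 d2 d3 d4"
    using conf_has_c4[OF conf, of d1 d2 d3 d4 "[x, p, q, y]"] no s by auto
  then have "has_tri adj d1 d2 d3 d4" using dense_has_c4_or_tri[OF dense] by blast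
  from conf_has_tri[OF conf this, of "[x, p, q, y]"] obtain d
    where conf: "cf (Suc (Suc r)) s' [d, x, p, q, y]" by auto
  have "\<not> tri adj x p q" "\<not> tri adj p q y"
    using conf_tri[OF conf, of x p q "[d, y]"] conf_tri[OF conf, of p q y "[d, x]"]
      surplus_triangles[OF s] no
    by auto
  then have non: "\<not> adj x q" "\<not> adj p y" using path by (auto simp: tri_def)
  let ?ds = "[x, p, q, y]"
  have "distinct ?ds" using conf_distinct[OF conf] by simp
  then have "8 * r + 8 * s' + 24 \<le> (\<Sum>x\<leftarrow>?ds. dg x)"
    using non ore_conf[OF conf, of x q] ore_conf[OF conf, of p y] by (simp add: s)
  \<comment> \<open>Three path edges counted twice, and at most four edges to
    \<open>d\<close>.\<close>
  moreover have "(\<Sum>v\<leftarrow>?ds. \<Sum>w\<leftarrow>[d, x, p, q, y]. of_bool (adj v w)) \<le> (10 :: nat)"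
    using non \<open>\<not> adj x y\<close> sym[of q x] sym[of y p] sym[of y x] by (simp add: irrefl of_bool_def)
  \<comment> \<open>Four per triangle is enough, since a vertex of the path with two neighbours on a
    triangle would close the missing quadrilateral with it.\<close>
  ultimately have "4 * Suc (Suc r) + 8 * s' + (\<Sum>v\<leftarrow>?ds. \<Sum>w\<leftarrow>[d, x, p, q, y]. of_bool (adj v w)) <
      (\<Sum>x\<leftarrow>?ds. dg x)"
    by simp
  with conf show False
  proof (cases rule: exchange)
    case (T i t1 t2 t3)
    have few: "of_bool (adj t1 v) + of_bool (adj t2 v) + of_bool (adj t3 v) \<le> (1 :: nat)"
      if "mset [d, x, p, q, y] = mset (v # ws)" for v ws
    proof (rule ccontr)
      assume "\<not> ?thesis"
      then have "has_c4 adj v t1 t2 t3" using tri_vertex_has_c4[OF T(3)] by simp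
      moreover have "mset ([t1, t2, t3] @ [d, x, p, q, y]) = mset (v # t1 # t2 # t3 # ws)"
        unfolding mset_append that by simp
      ultimately have "cf (Suc r) s ws"
        using conf_has_c4[OF T(2)] T(1) s by auto
      then show False using no by blast
    qed
    show False
      using T(4) few[of x "[d, p, q, y]"] few[of p "[d, x, q, y]"] few[of q "[d, x, p, y]"]
        few[of y "[d, x, p, q]"]
      by (simp add: at_least_pairs sym del: at_least.simps)
  next
    case (Q j q1 q2 q3 q4)
    then have "at_least 9 (pairs adj ?ds [q1, q2, q3, q4])" by simp
    from quad_path4[OF sym Q(3) path this] obtain a b c e f g h k where
      *: "mset [a, b, c, e, f, g, h, k] = mset [q1, q2, q3, q4, x, p, q, y]" "has_c4 adj a b c e"
      and **: "has_c4 adj f g h k \<or> has_tri adj f g h k"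
      by blast
    have "mset [q1, q2, q3, q4, d, x, p, q, y] = mset ([q1, q2, q3, q4, x, p, q, y] @ [d])" by simp
    also have "\<dots> = mset ([a, b, c, e, f, g, h, k] @ [d])" unfolding mset_append *(1) ..
    finally have conf': "cf (Suc (Suc r)) s' [f, g, h, k, d]"
      unfolding Q(1) by (intro conf_has_c4[OF Q(2) *(2)]) (simp only: append.simps)
    from ** show False
    proof
      assume "has_c4 adj f g h k"
      from conf_has_c4[OF conf' this, of "[d]"] have "cf (Suc (Suc r)) s [d]" by (simp add: s)
      \<comment> \<open>One of the \<open>Suc (Suc r)\<close> triangles is dissolved.\<close>
      then show False using no conf_take_tri by blast
    next
      assume "has_tri adj f g h k"
      from conf_has_tri[OF conf' this, of "[d]"] show False
        using surplus_triangles[OF s] no by auto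
    qed
  qed
qed

end

section \<open>Adding an edge\<close>

text \<open>The members are disjoint, so at most one uses the new edge. A triangle then leaves a
  third vertex \<open>z\<close>, and a quadrilateral leaves a path from \<open>x\<close> to
  \<open>y\<close> made of old edges.\<close>

lemma conf_insert_edge:
  assumes "conf V (\<lambda>u v. adj u v \<or> u = x \<and> v = y \<or> u = y \<and> v = x) i j xs"
    and sym: "\<And>u v. adj u v = adj v u"
  shows "conf V adj i j xs \<or>
    (\<exists>i' z. i = Suc i' \<and> conf V adj i' j (x # y # z # xs)) \<or>
    (\<exists>j' p q. j = Suc j' \<and> conf V adj i j' (x # p # q # y # xs) \<and> adj x p \<and> adj p q \<and> adj q y)"
  using assms(1)
proof (induction rule: conf.induct)
  case (conf_start xs)
  then show ?case using conf.conf_start by blast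
next
  case (conf_tri i j ys p q t xs)
  show ?case using conf_tri.IH
  proof (elim disjE exE conjE)
    assume *: "conf V adj i j ys"
    have **: "conf V adj i j (p # q # t # xs)" by (rule conf_perm[OF * conf_tri(3)])
    show ?thesis
    proof (cases "tri adj p q t")
      case True
      then show ?thesis using conf.conf_tri[OF * _ conf_tri(3)] by blast
    next
      case False
      then have "{p, q} = {x, y} \<or> {q, t} = {x, y} \<or> {p, t} = {x, y}"
        using conf_tri(2) by (auto simp: tri_def doubleton_eq_iff)
      then have "\<exists>z. mset (p # q # t # xs) = mset (x # y # z # xs)"
        by (auto simp: doubleton_eq_iff)
      then show ?thesis using conf_perm[OF **] by blast
    qed
  next
    fix i' z
    assume *: "i = Suc i'" "conf V adj i' j (x # y # z # ys)"
    have "distinct (x # y # z # ys)" using *(2) conf_distinct by blast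
    \<comment> \<open>Here \<open>x\<close> and \<open>y\<close> belong to the member already
      damaged, so the new edge cannot occur in this one.\<close>
    then have "tri adj p q t"
      using conf_tri(2) mset_eq_setD[OF conf_tri(3)] by (auto simp: tri_def)
    from conf.conf_tri[OF *(2) this, of "x # y # z # xs"] show ?thesis
      using conf_tri(3) *(1) by auto
  next
    fix j' a b
    assume *: "j = Suc j'" "conf V adj i j' (x # a # b # y # ys)" "adj x a" "adj a b" "adj b y"
    have "distinct (x # a # b # y # ys)" using *(2) conf_distinct by blast
    then have "tri adj p q t"
      using conf_tri(2) mset_eq_setD[OF conf_tri(3)] by (auto simp: tri_def)
    from conf.conf_tri[OF *(2) this, of "x # a # b # y # xs"] show ?thesis
      using conf_tri(3) * by auto
  qed
next
  case (conf_c4 i j ys p q t u xs)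
  show ?case using conf_c4.IH
  proof (elim disjE exE conjE)
    assume *: "conf V adj i j ys"
    have **: "conf V adj i j (p # q # t # u # xs)" by (rule conf_perm[OF * conf_c4(3)])
    have dist: "distinct [p, q, t, u]" using conf_distinct[OF **] by simp
    show ?thesis
    proof (cases "c4 adj p q t u")
      case True
      then show ?thesis using conf.conf_c4[OF * _ conf_c4(3)] by blast
    next
      case False
      \<comment> \<open>In the cyclic order \<open>x\<close>, \<open>y\<close>, \<open>c\<close>,
        \<open>d\<close> the old edges form the path \<open>x\<close>, \<open>d\<close>,
        \<open>c\<close>, \<open>y\<close>. The new edge may be any of the four sides in either
        direction, hence eight instances below.\<close>
      have path: "\<exists>a b. mset (p # q # t # u # xs) = mset (x # a # b # y # xs) \<and>
          adj x a \<and> adj a b \<and> adj b y"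
        if "mset (p # q # t # u # xs) = mset (x # y # c # d # xs)"
          "c4 (\<lambda>u v. adj u v \<or> u = x \<and> v = y \<or> u = y \<and> v = x) x y c d"
        for c d
      proof -
        have "distinct [x, y, c, d]"
          using conf_distinct[OF conf_perm[OF ** that(1)]] by simp
        then have "adj x d" "adj d c" "adj c y"
          using that(2) sym[of d x] sym[of c d] sym[of c y] by (auto simp: c4_def)
        then show ?thesis
          using that(1) by (intro exI[of _ d] exI[of _ c]) (simp add: add_mset_commute)
      qed
      have "p = x \<and> q = y \<or> p = y \<and> q = x \<or> q = x \<and> t = y \<or> q = y \<and> t = x \<or>
          t = x \<and> u = y \<or> t = y \<and> u = x \<or> u = x \<and> p = y \<or> u = y \<and> p = x"
        using False conf_c4(2) by (auto simp: c4_def)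
      then have "\<exists>a b. mset (p # q # t # u # xs) = mset (x # a # b # y # xs) \<and>
          adj x a \<and> adj a b \<and> adj b y"
      proof (elim disjE conjE)
      qed (rule path[of t u] path[of u t] path[of u p] path[of p u] path[of p q] path[of q p]
          path[of q t] path[of t q]; use conf_c4(2) sym in \<open>auto simp: c4_def\<close>)+
      then show ?thesis using conf_perm[OF **] by blast
    qed
  next
    fix i' z
    assume *: "i = Suc i'" "conf V adj i' j (x # y # z # ys)"
    have "distinct (x # y # z # ys)" using *(2) conf_distinct by blast
    then have "c4 adj p q t u"
      using conf_c4(2) mset_eq_setD[OF conf_c4(3)] by (auto simp: c4_def)
    from conf.conf_c4[OF *(2) this, of "x # y # z # xs"] show ?thesis
      using conf_c4(3) *(1) by auto
  next
    fix j' a b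
    assume *: "j = Suc j'" "conf V adj i j' (x # a # b # y # ys)" "adj x a" "adj a b" "adj b y"
    have "distinct (x # a # b # y # ys)" using *(2) conf_distinct by blast
    then have "c4 adj p q t u"
      using conf_c4(2) mset_eq_setD[OF conf_c4(3)] by (auto simp: c4_def)
    from conf.conf_c4[OF *(2) this, of "x # a # b # y # xs"] show ?thesis
      using conf_c4(3) * by auto
  qed
qed

text \<open>The starting point for the addition of edges: members can be chosen greedily.\<close>

lemma conf_complete:
  assumes "finite V" "\<And>u v. u \<in> V \<Longrightarrow> v \<in> V \<Longrightarrow> u \<noteq> v \<Longrightarrow> adj u v" "3 * i + 4 * j \<le> card V"
  shows "\<exists>xs. conf V adj i j xs"
  using assms(3)
proof (induction j)
  case 0
  then show ?case
  proof (induction i)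
    case 0
    then show ?case using finite_distinct_list[OF assms(1)] conf_start by blast
  next
    case (Suc i)
    then obtain ys where ys: "conf V adj i 0 ys" by auto
    then have "3 \<le> length ys" using conf_length[OF ys] Suc.prems by simp
    then obtain p q t xs where eq: "ys = p # q # t # xs"
      by (metis Suc_le_length_iff numeral_3_eq_3)
    then have "tri adj p q t"
      using conf_distinct[OF ys] conf_subset[OF ys] assms(2) by (auto simp: tri_def)
    then show ?case using conf_tri[OF ys, of p q t xs] eq by blast
  qed
next
  case (Suc j)
  then obtain ys where ys: "conf V adj i j ys" by auto
  then have "4 \<le> length ys" using conf_length[OF ys] Suc.prems by simp
  then obtain p q t u xs where eq: "ys = p # q # t # u # xs"
    by (metis Suc_le_length_iff eval_nat_numeral(2) numeral_3_eq_3 semiring_norm(26,27))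
  then have "c4 adj p q t u"
    using conf_distinct[OF ys] conf_subset[OF ys] assms(2) by (auto simp: c4_def)
  then show ?case using conf_c4[OF ys, of p q t u xs] eq by blast
qed

section \<open>From edge sets to adjacency, and the induction on missing edges\<close>

lemma degree_eq_deg: "finite V \<Longrightarrow> degree V E x = deg V (\<lambda>u v. {u, v} \<in> E) x"
  by (simp add: degree_def deg_def of_bool_def sum.If_cases insert_commute Int_def)

lemma ore_graph_sigma2:
  assumes "simple_graph V E" "sigma2_ge V E (card V + Suc r)" "card V = 3 * Suc r + 4 * Suc s"
  shows "ore_graph V (\<lambda>u v. {u, v} \<in> E) r s"
proof
  show "({x, y} \<in> E) = ({y, x} \<in> E)" for x y by (simp add: insert_commute)
  show "{x, x} \<notin> E" for x
    using assms(1) by (force simp: simple_graph_def doubleton_eq_iff)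
  show "4 * r + 4 * s + 8 \<le> deg V (\<lambda>u v. {u, v} \<in> E) x + deg V (\<lambda>u v. {u, v} \<in> E) y"
    if "x \<in> V" "y \<in> V" "x \<noteq> y" "{x, y} \<notin> E" for x y
  proof -
    have "card V + Suc r \<le> degree V E x + degree V E y"
      using assms(2) that by (auto simp: sigma2_ge_def)
    then show ?thesis
      using assms(1,3) by (simp add: simple_graph_def degree_eq_deg)
  qed
qed

text \<open>Up to a constant depending on \<open>V\<close> the measure is the number of missing
  edges. Added edges do not lower degrees, so the denser graph satisfies the hypotheses. The density
  of the leftover set is part of the induction because it helps to repair a damaged member.\<close>

lemma conf_exists:
  assumes "simple_graph V E" "sigma2_ge V E (card V + Suc r)" "card V = 3 * Suc r + 4 * Suc s"
  shows "\<exists>a b c d. conf V (\<lambda>u v. {u, v} \<in> E) (Suc r) s [a, b, c, d] \<and>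
    at_least 4 (edges4 (\<lambda>u v. {u, v} \<in> E) a b c d)"
  using assms
proof (induction "card (Pow V - E)" arbitrary: E rule: less_induct)
  case less
  let ?adj = "\<lambda>u v. {u, v} \<in> E"
  interpret ore_graph V ?adj r s by (rule ore_graph_sigma2[OF less.prems])
  have fin: "finite V" using less.prems by (simp add: simple_graph_def)
  have "\<exists>xs. cf (Suc r) s xs"
  proof (cases "\<forall>u\<in>V. \<forall>v\<in>V. u \<noteq> v \<longrightarrow> {u, v} \<in> E")
    case True
    then show ?thesis using conf_complete[of V ?adj "Suc r" s] fin less.prems(3) by auto
  next
    case False
    then obtain x y where xy: "x \<in> V" "y \<in> V" "x \<noteq> y" "{x, y} \<notin> E" by blast
    let ?E = "insert {x, y} E"
    have eq: "(\<lambda>u v. {u, v} \<in> ?E) = (\<lambda>u v. ?adj u v \<or> u = x \<and> v = y \<or> u = y \<and> v = x)"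
      by (auto simp: fun_eq_iff doubleton_eq_iff)
    have "card (Pow V - ?E) < card (Pow V - E)"
      using xy fin by (intro psubset_card_mono) auto
    moreover have "simple_graph V ?E" using less.prems(1) xy by (auto simp: simple_graph_def)
    moreover have "degree V E v \<le> degree V ?E v" for v
      unfolding degree_def using fin by (intro card_mono) auto
    then have "sigma2_ge V ?E (card V + Suc r)"
      using less.prems(2) unfolding sigma2_ge_def by (meson add_mono insertCI order_trans)
    ultimately obtain a b c d where conf: "conf V (\<lambda>u v. {u, v} \<in> ?E) (Suc r) s [a, b, c, d]"
      and dense: "at_least 4 (edges4 (\<lambda>u v. {u, v} \<in> ?E) a b c d)"
      using less.hyps less.prems(3) by blast
    have dense': "at_least 4 (edges4 ?adj a b c d)" if "x \<notin> {a, b, c, d}"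
    proof -
      have "edges4 (\<lambda>u v. {u, v} \<in> ?E) a b c d = edges4 ?adj a b c d"
        unfolding eq edges4_def using that by auto
      then show ?thesis using dense by simp
    qed
    from conf_insert_edge[OF conf[unfolded eq] sym] show ?thesis
    \<comment> \<open>If no member is damaged, the leftover set may contain the new edge; its
      density is restored at the very end.\<close>
    proof (elim disjE exE conjE)
      assume "cf (Suc r) s [a, b, c, d]"
      then show ?thesis ..
    next
      fix i z
      assume *: "Suc r = Suc i" "cf i s [x, y, z, a, b, c, d]"
      \<comment> \<open>The leftover set avoids the damaged triangle and keeps its edges. A triangle
        in it replaces the lost one; a quadrilateral in it becomes the surplus one of
        \<open>missing_triangle\<close>.\<close>
      then have "has_c4 ?adj a b c d \<or> has_tri ?adj a b c d"
        using conf_distinct[OF *(2)] dense' dense_has_c4_or_tri by simp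
      then show ?thesis
      proof
        assume "has_c4 ?adj a b c d"
        from conf_has_c4[OF *(2) this, of "[x, y, z]"] show ?thesis
          using missing_triangle *(1) by simp
      next
        assume "has_tri ?adj a b c d"
        from conf_has_tri[OF *(2) this, of "[x, y, z]"] show ?thesis using *(1) by auto
      qed
    next
      fix j p q
      assume *: "s = Suc j" "cf (Suc r) j [x, p, q, y, a, b, c, d]"
        "?adj x p" "?adj p q" "?adj q y"
      then show ?thesis
        using conf_distinct[OF *(2)] dense' missing_quad[OF * xy(4)] by simp
    qed
  qed
  then obtain xs where xs: "cf (Suc r) s xs" by blast
  then have "length xs = 4" using conf_length[OF xs] less.prems(3) by simp
  then obtain a b c d where "xs = [a, b, c, d]"
    by (auto simp: numeral_eq_Suc length_Suc_conv)
  then show ?case using leftover_dense xs by blast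
qed

section \<open>Translation back to sets of vertices\<close>

lemma is_triangle_tri:
  assumes "tri (\<lambda>u v. {u, v} \<in> E) p q t" "distinct [p, q, t]" "{p, q, t} \<subseteq> V"
  shows "is_triangle V E {p, q, t}"
  unfolding is_triangle_def
  by (rule exI[of _ p], rule exI[of _ q], rule exI[of _ t]) (use assms in \<open>simp add: tri_def\<close>)

lemma is_quad_c4:
  assumes "c4 (\<lambda>u v. {u, v} \<in> E) p q t u" "distinct [p, q, t, u]" "{p, q, t, u} \<subseteq> V"
  shows "is_quad V E {p, q, t, u}"
  unfolding is_quad_def
  by (rule exI[of _ p], rule exI[of _ q], rule exI[of _ t], rule exI[of _ u])
    (use assms in \<open>simp add: c4_def\<close>)

text \<open>All earlier members avoid the vertices left at their stage, so each newly removed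
  member, taken from these vertices, is disjoint from them.\<close>

lemma conf_lists:
  assumes "conf V (\<lambda>u v. {u, v} \<in> E) i j xs"
  shows "\<exists>Ts Qs. length Ts = i \<and> length Qs = j \<and>
    (\<forall>T\<in>set Ts. is_triangle V E T) \<and> (\<forall>Q\<in>set Qs. is_quad V E Q) \<and>
    sorted_wrt (\<lambda>A B. A \<inter> B = {}) (Ts @ Qs) \<and> (\<forall>P\<in>set (Ts @ Qs). P \<inter> set xs = {})"
  using assms
proof (induction rule: conf.induct)
  case (conf_start xs)
  then show ?case by auto
next
  case (conf_tri i j ys p q t xs)
  obtain Ts Qs where *: "length Ts = i" "length Qs = j"
    "\<forall>T\<in>set Ts. is_triangle V E T" "\<forall>Q\<in>set Qs. is_quad V E Q"
    "sorted_wrt (\<lambda>A B. A \<inter> B = {}) (Ts @ Qs)" "\<forall>P\<in>set (Ts @ Qs). P \<inter> set ys = {}"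
    using conf_tri.IH by blast
  have set: "set ys = {p, q, t} \<union> set xs" and dist: "distinct (p # q # t # xs)"
    using mset_eq_setD[OF conf_tri(3)] conf_distinct[OF conf_tri(1)]
      mset_eq_imp_distinct_iff[OF conf_tri(3)] by auto
  have "is_triangle V E {p, q, t}"
    using conf_tri(2) dist set conf_subset[OF conf_tri(1)] by (intro is_triangle_tri) auto
  moreover have "{p, q, t} \<inter> P = {}" "P \<inter> set xs = {}" if "P \<in> set (Ts @ Qs)" for P
  proof -
    have "P \<inter> set ys = {}" using *(6) that by blast
    then show "{p, q, t} \<inter> P = {}" "P \<inter> set xs = {}" unfolding set by blast+
  qed
  moreover have "{p, q, t} \<inter> set xs = {}" using dist by auto
  ultimately show ?case
    using * by (rule_tac x = "{p, q, t} # Ts" in exI, rule_tac x = Qs in exI) simp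
next
  case (conf_c4 i j ys p q t u xs)
  obtain Ts Qs where *: "length Ts = i" "length Qs = j"
    "\<forall>T\<in>set Ts. is_triangle V E T" "\<forall>Q\<in>set Qs. is_quad V E Q"
    "sorted_wrt (\<lambda>A B. A \<inter> B = {}) (Ts @ Qs)" "\<forall>P\<in>set (Ts @ Qs). P \<inter> set ys = {}"
    using conf_c4.IH by blast
  have set: "set ys = {p, q, t, u} \<union> set xs" and dist: "distinct (p # q # t # u # xs)"
    using mset_eq_setD[OF conf_c4(3)] conf_distinct[OF conf_c4(1)]
      mset_eq_imp_distinct_iff[OF conf_c4(3)] by auto
  have "is_quad V E {p, q, t, u}"
    using conf_c4(2) dist set conf_subset[OF conf_c4(1)] by (intro is_quad_c4) auto
  moreover have "P \<inter> {p, q, t, u} = {}" "P \<inter> set xs = {}" if "P \<in> set (Ts @ Qs)" for P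
  proof -
    have "P \<inter> set ys = {}" using *(6) that by blast
    then show "P \<inter> {p, q, t, u} = {}" "P \<inter> set xs = {}" unfolding set by blast+
  qed
  moreover have "{p, q, t, u} \<inter> set xs = {}" using dist by auto
  ultimately show ?case
    using * by (rule_tac x = Ts in exI, rule_tac x = "{p, q, t, u} # Qs" in exI)
      (auto simp: sorted_wrt_append)
qed

lemma is_dense4_edges4:
  assumes "distinct [a, b, c, d]" "{a, b, c, d} \<subseteq> V" "at_least 4 (edges4 (\<lambda>u v. {u, v} \<in> E) a b c d)"
  shows "is_dense4 V E {a, b, c, d}"
proof -
  let ?es = "[{a, b}, {a, c}, {a, d}, {b, c}, {b, d}, {c, d}]"
  let ?fs = "filter (\<lambda>e. e \<in> E) ?es"
  \<comment> \<open>The six pairs are different as sets, so counting true entries counts edges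
    without repetition.\<close>
  have "distinct ?es" using assms(1) by (auto simp: doubleton_eq_iff)
  then have "card (set ?fs) = length ?fs" by (intro distinct_card distinct_filter)
  moreover have "length ?fs = (\<Sum>b\<leftarrow>edges4 (\<lambda>u v. {u, v} \<in> E) a b c d. of_bool b)"
    by (simp add: edges4_def)
  then have "4 \<le> length ?fs" using assms(3) by (simp only: at_least_iff)
  moreover have "card (set ?fs) \<le> card {e \<in> E. e \<subseteq> {a, b, c, d}}"
  proof (rule card_mono)
    show "finite {e \<in> E. e \<subseteq> {a, b, c, d}}"
      by (rule finite_subset[of _ "Pow {a, b, c, d}"]) auto
    have "set ?es \<subseteq> Pow {a, b, c, d}" by simp
    then show "set ?fs \<subseteq> {e \<in> E. e \<subseteq> {a, b, c, d}}" unfolding set_filter by blast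
  qed
  ultimately show ?thesis using assms(1,2) by (simp add: is_dense4_def del: filter.simps)
qed

theorem theorem1:
  fixes V :: "'a set" and E :: "'a set set" and r s :: nat
  assumes "simple_graph V E"
    and "r \<ge> 1" and "s \<ge> 1"
    and "card V = 3 * r + 4 * s"
    and "sigma2_ge V E (card V + r)"
  shows "\<exists>Ts Qs D. length Ts = r \<and> length Qs = s - 1 \<and>
           (\<forall>T\<in>set Ts. is_triangle V E T) \<and>
           (\<forall>Q\<in>set Qs. is_quad V E Q) \<and>
           is_dense4 V E D \<and>
           (let Ps = Ts @ Qs @ [D] in
              \<forall>i<length Ps. \<forall>j<length Ps. i \<noteq> j \<longrightarrow> Ps ! i \<inter> Ps ! j = {})"
proof -
  obtain r' s' where rs: "r = Suc r'" "s = Suc s'"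
    using assms(2,3) by (metis One_nat_def Suc_le_D)
  obtain a b c d where conf: "conf V (\<lambda>u v. {u, v} \<in> E) r s' [a, b, c, d]"
    and dense: "at_least 4 (edges4 (\<lambda>u v. {u, v} \<in> E) a b c d)"
    using conf_exists[OF assms(1), of r' s'] assms(4,5) rs by auto
  obtain Ts Qs where *: "length Ts = r" "length Qs = s'"
    "\<forall>T\<in>set Ts. is_triangle V E T" "\<forall>Q\<in>set Qs. is_quad V E Q"
    "sorted_wrt (\<lambda>A B. A \<inter> B = {}) (Ts @ Qs)" "\<forall>P\<in>set (Ts @ Qs). P \<inter> {a, b, c, d} = {}"
    using conf_lists[OF conf] by auto
  let ?Ps = "Ts @ Qs @ [{a, b, c, d}]"
  have sorted: "sorted_wrt (\<lambda>A B. A \<inter> B = {}) ?Ps"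
    using *(5,6) by (auto simp: sorted_wrt_append)
  \<comment> \<open>\<open>sorted_wrt\<close> compares earlier with later positions; symmetry of
    disjointness covers the other order.\<close>
  have before: "?Ps ! i \<inter> ?Ps ! j = {}" if "i < j" "j < length ?Ps" for i j
    by (rule sorted_wrt_nth_less[OF sorted that])
  have "?Ps ! i \<inter> ?Ps ! j = {}" if "i < length ?Ps" "j < length ?Ps" "i \<noteq> j" for i j
    using that(3)
  proof (rule linorder_neqE_nat)
    assume "i < j"
    then show ?thesis using that(2) by (rule before)
  next
    assume "j < i"
    then show ?thesis using before[of j i] that(1) by (simp only: Int_commute)
  qed
  moreover have "is_dense4 V E {a, b, c, d}"
    using is_dense4_edges4 conf_distinct[OF conf] conf_subset[OF conf] dense by simp
  ultimately show ?thesis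
    using *(1-4) rs(2) by (intro exI[of _ Ts] exI[of _ Qs] exI[of _ "{a, b, c, d}"]) (simp add: Let_def)
qed

end
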